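(* For $R>1$ let $B_R\subset\mathbb{R}^2$ be the open disc of radius $R$. Then $\tilde\tau_1(B_R)$ has the following asymptotic behaviour: $$\tilde\tau_1(B_R)\approx -R^2(\log R)^2\ \text{ for } R \text{ near } 1,\qquad \tilde\tau_1(B_R)\approx-\frac{R^2\log R}{2}\ \text{ for } R\text{ near }\infty,$$ i.e. $\displaystyle\lim_{R\to1^+}\frac{\tilde\tau_1(B_R)}{-R^2(\log R)^2}=1$ and $\displaystyle\lim_{R\to\infty}\frac{\tilde\tau_1(B_R)}{-\frac12R^2\log R}=1$.
   Context: For a bounded open set $\Omega\subset\mathbb{R}^2$, $\tilde\tau_1(\Omega):=\inf\{E(u):u\in L^2(\Omega),\ \|u\|_{L^2(\Omega)}=1\}$, where $E(u)=\frac{1}{2\pi}\int_\Omega\int_\Omega\log\frac{1}{|x-y|}u(x)u(y)\,dx\,dy$. For $\Omega=B_R$ with $R>1$, this is the unique negative eigenvalue of the Logarithmic potential operator $\mathcal{L}u(x)=\frac{1}{2\pi}\int_\Omega\log\frac{1}{|x-y|}u(y)\,dy$ on $L^2(\Omega)$. *)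

theory Defs
  imports "HOL-Analysis.Analysis"
begin

text \<open>Real-valued square-integrable functions, as functions rather than as classes modulo
  a.e. equality; the norm and the energy below depend only on the class. Values outside
  \<open>\<Omega>\<close> are irrelevant.\<close>

definition L2_on :: "(real^2) set \<Rightarrow> (real^2 \<Rightarrow> real) set" where
  "L2_on \<Omega> = {u. u \<in> borel_measurable (lebesgue_on \<Omega>) \<and>
                 integrable (lebesgue_on \<Omega>) (\<lambda>x. (u x)\<^sup>2)}"

definition L2_norm_on :: "(real^2) set \<Rightarrow> (real^2 \<Rightarrow> real) \<Rightarrow> real" where
  "L2_norm_on \<Omega> u = sqrt (LINT x|lebesgue_on \<Omega>. (u x)\<^sup>2)"

text \<open>On the diagonal the kernel takes the junk value \<open>ln (1 / 0) = 0\<close>, which only concerns a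
  null set. For bounded \<open>\<Omega>\<close> and \<open>u \<in> L2_on \<Omega>\<close> the inner integral converges
  absolutely for every \<open>x\<close>.\<close>

definition log_energy :: "(real^2) set \<Rightarrow> (real^2 \<Rightarrow> real) \<Rightarrow> real" where
  "log_energy \<Omega> u = 1 / (2 * pi) *
     (LINT x|lebesgue_on \<Omega>. LINT y|lebesgue_on \<Omega>. ln (1 / norm (x - y)) * u x * u y)"

text \<open>For nonempty bounded open \<open>\<Omega>\<close> the infimum is over a nonempty set that is bounded
  below, so the real-valued \<open>Inf\<close> is the genuine infimum.\<close>

definition tau1 :: "(real^2) set \<Rightarrow> real" where
  "tau1 \<Omega> = Inf {log_energy \<Omega> u | u. u \<in> L2_on \<Omega> \<and> L2_norm_on \<Omega> u = 1}"

end

theory Submission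
  imports Defs
begin

text \<open>Write \<open>L = ln R\<close> and split \<open>ln (1 / |x - y|) = ln (R / |x - y|) - L\<close>. With
\<open>B(v, w)\<close> the double integral of \<open>ln (R / |x - y|) v(x) w(y)\<close> over the disc of radius \<open>R\<close> (the
constant \<open>log_form\<close>), the energy of \<open>u\<close> is \<open>(B(u, u) - L (\<integral>u)\<^sup>2) / (2\<pi>)\<close>. Everything rests on two
properties of \<open>B\<close>.

Positivity (\<open>log_form_nonneg\<close>). Identify the plane with the complex numbers, let
\<open>m = max |x| |y|\<close> and \<open>z = x cnj(y) / m\<^sup>2\<close>. Then \<open>|1 - z| = |x - y| / m\<close>, so off the diagonal the
kernel is \<open>ln (R / m) + \<Sum>k\<ge>1. Re (z^k) / k\<close>. Here \<open>ln (R / m)\<close> is the minimum of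
\<open>ln (R / |x|)\<close> and \<open>ln (R / |y|)\<close>, and \<open>Re (z^k)\<close> is
\<open>Re (x^k) Re (y^k) + Im (x^k) Im (y^k)\<close> times the minimum of \<open>|x|^(-2k)\<close> and \<open>|y|^(-2k)\<close>. A
kernel \<open>a(x) a(y) min (g x) (g y)\<close> with \<open>g \<ge> 0\<close> is positive semidefinite because the minimum is
the length of \<open>{t. 0 \<le> t < g x \<and> t < g y}\<close> (\<open>layer_cake_kernel_nonneg\<close>). The series does not
converge absolutely where \<open>|x| = |y|\<close>, so it is first damped by \<open>s^k\<close>,
\<open>s < 1\<close> (\<open>max_kernel_le_log_kernel\<close>).

Radial functions (\<open>log_form_powr\<close>). If \<open>w\<close> is radial, the terms with \<open>k \<ge> 1\<close> integrate to zero,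
since the rotation by \<open>\<pi> / k\<close> changes their sign. Only \<open>ln (R / m)\<close> is left, and for
\<open>w(x) = |x|^(N - 2)\<close>, \<open>N > 1\<close>, the potential of \<open>w\<close> is \<open>2\<pi> (R^N - |x|^N) / N\<^sup>2\<close>. Therefore the
positive semidefinite form \<open>A(u, v) = B(u, v) + (2\<pi> / N\<^sup>2) \<integral>|x|\<^sup>2 u v\<close> satisfies
\<open>A(v, w) = (2\<pi> R^N / N\<^sup>2) \<integral>v\<close> exactly: up to a factor, \<open>w\<close> represents \<open>v \<mapsto> \<integral>v\<close>. The Cauchy-Schwarz
inequality for \<open>A\<close> gives \<open>(\<integral>v)\<^sup>2 \<le> N B(v, v) + (2\<pi> R\<^sup>2 / N) \<parallel>v\<parallel>\<^sup>2\<close>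
(\<open>square_integral_le_log_form\<close>).

With \<open>N = 1 / L\<close> this inequality says that the infimum is at least \<open>- R\<^sup>2 L\<^sup>2\<close> when \<open>L < 1\<close>.
Positivity of \<open>B\<close> together with \<open>(\<integral>v)\<^sup>2 \<le> \<pi> R\<^sup>2 \<parallel>v\<parallel>\<^sup>2\<close> gives the other lower bound \<open>- R\<^sup>2 L / 2\<close>.
The normalised \<open>|x|^(N - 2)\<close> as trial function gives the upper bound
\<open>R\<^sup>2 (N - 1) (1 - 2 N L) / N\<^sup>3\<close>. This is \<open>- R\<^sup>2 L\<^sup>2 (1 - L)\<close> for \<open>N = 1 / L\<close>, a function
concentrating at the boundary as \<open>R\<close> tends to 1, and \<open>- R\<^sup>2 (L / 2 - 1 / 8)\<close> for \<open>N = 2\<close>, a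
constant function. In each regime the two bounds have the same leading term.\<close>

section \<open>Radial integrals and rotations of the plane\<close>

abbreviation disc :: "real \<Rightarrow> (real^2) measure" where
  "disc R \<equiv> lebesgue_on (ball 0 R)"

text \<open>Both measures give the half line up to \<open>a\<close> the area \<open>\<pi> a\<^sup>2\<close> of a disc. This replaces
polar coordinates for functions of the norm.\<close>

lemma distr_norm_lborel_plane:
  "distr (lborel :: (real^2) measure) borel norm
     = density lborel (\<lambda>t::real. ennreal (2 * pi * t) * indicator {0..} t)"
proof (rule measure_eqI_generator_eq)
  let ?E = "range (\<lambda>a::real. {..a})"
  show "Int_stable ?E" by (auto simp: Int_stable_def)
  show "?E \<subseteq> Pow UNIV" by simp
  show "sets (distr lborel borel norm) = sigma_sets UNIV ?E"
    by (simp add: borel_eq_atMost)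
  show "sets (density lborel (\<lambda>t::real. ennreal (2 * pi * t) * indicator {0..} t)) = sigma_sets UNIV ?E"
    by (simp add: borel_eq_atMost)
  show "range (\<lambda>i::nat. {..real i}) \<subseteq> ?E" by auto
  show "(\<Union>i::nat. {..real i}) = UNIV" using real_arch_simple by auto
  have *: "emeasure (distr (lborel :: (real^2) measure) borel norm) {..a} = (if a < 0 then 0 else ennreal (pi * a^2))" for a
  proof -
    have "emeasure (distr (lborel :: (real^2) measure) borel norm) {..a} = emeasure lborel (norm -` {..a} :: (real^2) set)"
      by (subst emeasure_distr) auto
    also have "(norm -` {..a} :: (real^2) set) = cball 0 a" by auto
    also have "emeasure lborel \<dots> = (if a < 0 then 0 else ennreal (pi * a^2))"
      by (auto simp: emeasure_cball unit_ball_vol_2 not_less)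
    finally show ?thesis .
  qed
  show "emeasure (distr (lborel :: (real^2) measure) borel norm) {..real i} \<noteq> \<infinity>" for i
    unfolding * by simp
  show "emeasure (distr (lborel :: (real^2) measure) borel norm) X
      = emeasure (density lborel (\<lambda>t::real. ennreal (2 * pi * t) * indicator {0..} t)) X" if "X \<in> ?E" for X
  proof -
    from that obtain a where X: "X = {..a}" by auto
    have "emeasure (density lborel (\<lambda>t::real. ennreal (2 * pi * t) * indicator {0..} t)) X
        = (\<integral>\<^sup>+t. ennreal (2 * pi * t) * indicator {0..a} t \<partial>lborel)"
      unfolding X by (subst emeasure_density) (auto intro!: nn_integral_cong simp: indicator_def)
    also have "\<dots> = (if a < 0 then 0 else ennreal (pi * a^2))"
    proof (cases "a < 0")
      case False
      have "(\<integral>\<^sup>+t. ennreal (2 * pi * t) * indicator {0..a} t \<partial>lborel) = ennreal (pi * a^2 - pi * 0^2)"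
        by (rule nn_integral_FTC_Icc) (use False in \<open>auto intro!: derivative_eq_intros\<close>)
      with False show ?thesis by simp
    qed simp
    finally show ?thesis unfolding X * by simp
  qed
qed

text \<open>Nonnegativity of \<open>f\<close> lets the value of the integral, computed by the fundamental theorem of
calculus, also establish integrability; this matters for profiles \<open>f\<close> that are singular at 0.\<close>

lemma has_bochner_integral_disc_radial:
  fixes f :: "real \<Rightarrow> real"
  assumes [measurable]: "f \<in> borel_measurable borel"
    and nonneg: "\<And>t. 0 < t \<Longrightarrow> t < R \<Longrightarrow> 0 \<le> f t"
    and int: "((\<lambda>t. 2 * pi * t * f t) has_integral I) {0..R}"
  shows "has_bochner_integral (disc R) (\<lambda>x. f (norm x)) I"
proof (rule has_bochner_integral_nn_integral)
  have int': "((\<lambda>t. 2 * pi * t * f t) has_integral I) {0<..<R}"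
    using int has_integral_Icc_iff_Ioo by blast
  have [measurable]: "ball 0 R \<in> sets (lebesgue :: (real^2) measure)" by simp
  have [measurable]: "(\<lambda>x::real^2. x) \<in> disc R \<rightarrow>\<^sub>M borel"
    by (intro measurable_restrict_space1 measurable_completion) simp
  show "(\<lambda>x. f (norm x)) \<in> borel_measurable (disc R)" by measurable
  show "0 \<le> I" using int' by (rule has_integral_nonneg) (use nonneg in auto)
  have ae: "AE x in lborel. x \<noteq> (0::real^2)"
    by (rule AE_I'[of "{0}"]) auto
  show "AE x in disc R. 0 \<le> f (norm x)"
    by (subst AE_restrict_space_iff) 
       (auto intro!: AE_completion eventually_mono[OF ae] nonneg)
  have "(\<integral>\<^sup>+x. ennreal (f (norm x)) \<partial>disc R)
      = (\<integral>\<^sup>+x. ennreal (f (norm (x::real^2))) * indicator (ball 0 R) x \<partial>lborel)"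
    by (simp add: nn_integral_restrict_space nn_integral_completion)
  also have "\<dots> = (\<integral>\<^sup>+x. ennreal (f (norm (x::real^2))) * indicator {..<R} (norm x) \<partial>lborel)"
    by (auto intro!: nn_integral_cong simp: indicator_def)
  also have "\<dots> = (\<integral>\<^sup>+t. ennreal (f t) * indicator {..<R} t \<partial>distr (lborel :: (real^2) measure) borel norm)"
    by (subst nn_integral_distr) auto
  also have "\<dots> = (\<integral>\<^sup>+t. ennreal (2 * pi * t) * indicator {0..} t * (ennreal (f t) * indicator {..<R} t) \<partial>lborel)"
    unfolding distr_norm_lborel_plane by (subst nn_integral_density) auto
  also have "\<dots> = (\<integral>\<^sup>+t. ennreal (2 * pi * t * f t) * indicator {0<..<R} t \<partial>lborel)"
  proof (intro nn_integral_cong, goal_cases)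
    case (1 t)
    show ?case using nonneg[of t] by (cases "0 < t \<and> t < R") (auto simp: indicator_def ennreal_mult)
  qed
  also have "\<dots> = ennreal I"
    by (rule nn_integral_has_integral_lebesgue'[OF _ int']) (use nonneg in auto)
  finally show "(\<integral>\<^sup>+x. ennreal (f (norm x)) \<partial>disc R) = ennreal I" .
qed

definition plane_complex :: "real^2 \<Rightarrow> complex" where
  "plane_complex x = Complex (x $ 1) (x $ 2)"

lemma norm_plane_complex [simp]: "cmod (plane_complex x) = norm x"
  by (simp add: plane_complex_def cmod_def norm_vec_def L2_set_def sum_2)

lemma plane_complex_diff: "plane_complex (x - y) = plane_complex x - plane_complex y"
  by (simp add: plane_complex_def complex_eq_iff)

lemma plane_complex_eq_0_iff [simp]: "plane_complex x = 0 \<longleftrightarrow> x = 0"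
  by (metis norm_eq_zero norm_plane_complex)

lemma plane_complex_0 [simp]: "plane_complex 0 = 0"
  by simp

lemma borel_measurable_plane_complex [measurable]: "plane_complex \<in> borel_measurable borel"
proof -
  have "continuous_on UNIV plane_complex"
    unfolding plane_complex_def Complex_eq by (intro continuous_intros)
  then show ?thesis by (rule borel_measurable_continuous_onI)
qed

definition rotation :: "real \<Rightarrow> real^2 \<Rightarrow> real^2" where
  "rotation a x = vector [cos a * x $ 1 - sin a * x $ 2, sin a * x $ 1 + cos a * x $ 2]"

lemma plane_complex_rotation: "plane_complex (rotation a x) = cis a * plane_complex x"
  by (simp add: rotation_def plane_complex_def complex_eq_iff)

lemma norm_rotation [simp]: "norm (rotation a x) = norm x"
  by (metis norm_plane_complex plane_complex_rotation norm_mult norm_cis mult_1)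

lemma linear_rotation: "linear (rotation a)"
  by (rule linearI) (simp_all add: rotation_def vec_eq_iff forall_2 algebra_simps)

lemma rotation_rotation: "rotation a (rotation (- a) x) = x"
proof -
  have "plane_complex (rotation a (rotation (- a) x)) = plane_complex x"
    by (simp add: plane_complex_rotation mult.assoc[symmetric] cis_mult)
  then show ?thesis by (simp add: plane_complex_def vec_eq_iff forall_2)
qed

lemma det_rotation: "det (matrix (rotation a)) = 1"
  by (simp add: det_2 matrix_def rotation_def axis_def flip: power2_eq_square)

text \<open>By \<open>measure_linear_image\<close>, as the rotation matrix has determinant 1.\<close>

lemma lborel_rotation: "distr lborel borel (rotation a) = lborel"
proof (rule lborel_eqI[symmetric])
  have cont: "continuous_on UNIV (rotation b)" for b
    using linear_rotation linear_continuous_on linear_conv_bounded_linear by blast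
  then have [measurable]: "rotation a \<in> borel_measurable borel"
    by (rule borel_measurable_continuous_onI)
  fix l u :: "real^2" assume le: "\<And>b. b \<in> Basis \<Longrightarrow> l \<bullet> b \<le> u \<bullet> b"
  have im: "rotation a -` box l u = rotation (- a) ` box l u"
    using rotation_rotation[of a] rotation_rotation[of "- a"] by (auto simp: image_iff) (metis+)
  have [measurable]: "rotation a -` box l u \<in> sets borel"
    using measurable_sets[of "rotation a" borel borel "box l u"] by simp
  have "emeasure lborel (rotation a -` box l u) = emeasure lebesgue (rotation (- a) ` box l u)"
    unfolding im[symmetric] by simp
  also have "\<dots> = ennreal (measure lebesgue (rotation (- a) ` box l u))"
    by (intro emeasure_eq_measure2) (auto intro!: measurable_linear_image simp: linear_rotation)
  also have "\<dots> = ennreal (measure lebesgue (box l u))"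
    by (subst measure_linear_image) (auto simp: linear_rotation det_rotation)
  finally show "emeasure (distr lborel borel (rotation a)) (box l u) = (\<Prod>b\<in>Basis. (u - l) \<bullet> b)"
    using le by (simp add: emeasure_distr)
qed simp

section \<open>Absolute convergence of the double integrals\<close>

lemma borel_measurable_disc:
  assumes "f \<in> borel_measurable borel"
  shows "f \<in> borel_measurable (disc R)"
  using assms by (intro measurable_restrict_space1 measurable_completion) simp

lemma borel_measurable_disc_pair:
  assumes "f \<in> borel_measurable (borel \<Otimes>\<^sub>M borel)"
  shows "f \<in> borel_measurable (disc R \<Otimes>\<^sub>M disc R)"
proof -
  have id: "(\<lambda>x. x) \<in> disc R \<rightarrow>\<^sub>M borel"
    by (intro measurable_restrict_space1 measurable_completion) simp
  have "(\<lambda>p. (fst p, snd p)) \<in> disc R \<Otimes>\<^sub>M disc R \<rightarrow>\<^sub>M borel \<Otimes>\<^sub>M borel"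
    by (intro measurable_Pair measurable_compose[OF measurable_fst id]
          measurable_compose[OF measurable_snd id])
  from measurable_compose[OF this assms] show ?thesis by simp
qed

interpretation disc: finite_measure "disc R" for R
  by (rule finite_measure_lebesgue_on) simp

interpretation disc_pair: pair_sigma_finite "disc R" "disc R" for R ..

lemma ball_borel [measurable]: "ball (0::real^2) R \<in> sets borel"
  by simp

lemma integral_disc_rotation:
  fixes f :: "real^2 \<Rightarrow> real"
  assumes [measurable]: "f \<in> borel_measurable borel"
  shows "(LINT x|disc R. f (rotation a x)) = (LINT x|disc R. f x)"
proof -
  have "continuous_on UNIV (rotation a)"
    using linear_rotation linear_continuous_on linear_conv_bounded_linear by blast
  then have [measurable]: "rotation a \<in> borel_measurable borel"
    by (rule borel_measurable_continuous_onI)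
  have to_lborel: "(LINT x|disc R. g x) = (LINT x|lborel. indicator (ball 0 R) x *\<^sub>R g x)"
    if [measurable]: "g \<in> borel_measurable borel" for g :: "real^2 \<Rightarrow> real"
  proof -
    have "(\<lambda>x. indicator (ball 0 R) x *\<^sub>R g x) \<in> borel_measurable lborel"
      using that by (intro borel_measurable_scaleR borel_measurable_indicator) auto
    from integral_completion[OF this] show ?thesis by (subst integral_restrict_space) simp_all
  qed
  have "(LINT x|disc R. f x)
      = (LINT x|distr lborel borel (rotation a). indicator (ball 0 R) x *\<^sub>R f x)"
    by (simp add: to_lborel lborel_rotation)
  also have "\<dots> = (LINT x|lborel. indicator (ball 0 R) (rotation a x) *\<^sub>R f (rotation a x))"
    by (subst integral_distr) auto
  also have "\<dots> = (LINT x|disc R. f (rotation a x))"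
    by (subst to_lborel) (auto intro!: Bochner_Integration.integral_cong simp: indicator_def)
  finally show ?thesis ..
qed

text \<open>After translating the pole to the origin, the disc is contained in the disc of radius \<open>2 R\<close>
about it, where \<open>|ln t| \<le> t + 1 / t\<close> has a finite integral in the plane.\<close>

lemma log_kernel_uniformly_integrable:
  obtains C where "0 \<le> C"
    and "\<And>x. x \<in> ball (0::real^2) R \<Longrightarrow>
           (\<integral>\<^sup>+y. ennreal (1 + \<bar>ln (norm (x - y))\<bar>) \<partial>disc R) \<le> ennreal C"
proof -
  define f where "f t = 1 + t + 1 / t" for t :: real
  have log_le: "1 + \<bar>ln t\<bar> \<le> f t" if "0 \<le> t" for t :: real
  proof (cases "t = 0")
    case False
    with that have "ln t \<le> t" "- ln t \<le> 1 / t" "0 < 1 / t"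
      using ln_bound[of t] ln_bound[of "1 / t"] by (auto simp: ln_div)
    with that show ?thesis unfolding f_def by linarith
  qed (simp add: f_def)
  have [measurable]: "f \<in> borel_measurable borel" unfolding f_def by measurable
  define F where "F t = 2 * pi * (t + t^2 / 2 + t^3 / 3)" for t :: real
  show thesis
  proof (cases "0 < R")
    case True
    have "((\<lambda>t. 2 * pi * (1 + t + t^2)) has_integral (F (2*R) - F 0)) {0..2*R}"
      unfolding F_def using True
      by (intro fundamental_theorem_of_calculus)
        (auto intro!: derivative_eq_intros simp: power2_eq_square algebra_simps
           simp flip: has_real_derivative_iff_has_vector_derivative)
    then have int: "((\<lambda>t. 2 * pi * t * f t) has_integral (F (2*R) - F 0)) {0..2*R}"
      by (rule has_integral_spike_finite[of "{0}", rotated 2])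
        (auto simp: f_def field_simps power2_eq_square)
    have bochner: "has_bochner_integral (disc (2*R)) (\<lambda>x. f (norm x)) (F (2*R) - F 0)"
      by (rule has_bochner_integral_disc_radial[OF _ _ int]) (auto simp: f_def)
    have nonneg: "0 \<le> f (norm z)" for z :: "real^2" by (simp add: f_def)
    have total: "(\<integral>\<^sup>+z. ennreal (f (norm z)) \<partial>disc (2*R)) = ennreal (F (2*R) - F 0)"
      using bochner nn_integral_eq_integral[of "disc (2*R)" "\<lambda>x. f (norm x)"] nonneg
      by (auto simp: has_bochner_integral_iff)
    show thesis
    proof (rule that)
      show "0 \<le> F (2*R) - F 0" using True by (simp add: F_def)
      fix x :: "real^2" assume x: "x \<in> ball 0 R"
      have "(\<integral>\<^sup>+y. ennreal (1 + \<bar>ln (norm (x - y))\<bar>) \<partial>disc R)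
          = (\<integral>\<^sup>+y. ennreal (1 + \<bar>ln (norm (x - y))\<bar>) * indicator (ball 0 R) y \<partial>lborel)"
        by (simp add: nn_integral_restrict_space nn_integral_completion)
      also have "\<dots> \<le> (\<integral>\<^sup>+y. ennreal (f (norm (y - x))) * indicator (ball 0 (2*R)) (y - x) \<partial>lborel)"
      proof (rule nn_integral_mono)
        fix y
        show "ennreal (1 + \<bar>ln (norm (x - y))\<bar>) * indicator (ball 0 R) y
            \<le> ennreal (f (norm (y - x))) * indicator (ball 0 (2*R)) (y - x)"
        proof (cases "y \<in> ball 0 R")
          case True
          then have "norm (y - x) < 2 * R" using x norm_triangle_ineq4[of y x] by auto
          then show ?thesis using True log_le[of "norm (y - x)"]
            by (auto intro!: ennreal_leI simp: norm_minus_commute simp del: ennreal_plus)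
        qed simp
      qed
      also have "\<dots> = (\<integral>\<^sup>+y. ennreal (f (norm (y - x))) * indicator (ball 0 (2*R)) (y - x)
                       \<partial>distr lborel borel ((+) x))"
        by (simp add: lborel_distr_plus)
      also have "\<dots> = (\<integral>\<^sup>+z. ennreal (f (norm (z::real^2))) * indicator (ball 0 (2*R)) z \<partial>lborel)"
        by (subst nn_integral_distr) auto
      also have "\<dots> = ennreal (F (2*R) - F 0)"
        unfolding total[symmetric] by (simp add: nn_integral_restrict_space nn_integral_completion)
      finally show "(\<integral>\<^sup>+y. ennreal (1 + \<bar>ln (norm (x - y))\<bar>) \<partial>disc R)
          \<le> ennreal (F (2*R) - F 0)" .
    qed
  next
    case False
    then have "ball (0::real^2) R = {}" by simp
    then show thesis using that[of 0] by blast
  qed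
qed

lemma abs_mult_le_sum_squares: "\<bar>a * b\<bar> \<le> a\<^sup>2 + b\<^sup>2" for a b :: real
proof -
  have "2 * (\<bar>a\<bar> * \<bar>b\<bar>) \<le> a\<^sup>2 + b\<^sup>2"
    using sum_squares_bound[of "\<bar>a\<bar>" "\<bar>b\<bar>"] by (simp add: mult.assoc)
  moreover have "0 \<le> \<bar>a\<bar> * \<bar>b\<bar>" by simp
  ultimately show ?thesis unfolding abs_mult by linarith
qed

text \<open>Schur's test: bound \<open>|v(x) w(y)|\<close> by \<open>v(x)\<^sup>2 + w(y)\<^sup>2\<close> and integrate the kernel over the other
variable first. Every kernel below is dominated by a multiple of \<open>1 + |ln |x - y||\<close>.\<close>

lemma integrable_log_kernel:
  assumes v: "v \<in> L2_on (ball 0 R)" and w: "w \<in> L2_on (ball 0 R)"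
  shows "integrable (disc R \<Otimes>\<^sub>M disc R)
           (\<lambda>p. (1 + \<bar>ln (norm (fst p - snd p))\<bar>) * (v (fst p) * w (snd p)))"
proof -
  obtain C where C: "0 \<le> C" "\<And>x. x \<in> ball (0::real^2) R \<Longrightarrow>
      (\<integral>\<^sup>+y. ennreal (1 + \<bar>ln (norm (x - y))\<bar>) \<partial>disc R) \<le> ennreal C"
    using log_kernel_uniformly_integrable by blast
  have [measurable]: "v \<in> borel_measurable (disc R)" "w \<in> borel_measurable (disc R)"
    and v2: "integrable (disc R) (\<lambda>x. (v x)\<^sup>2)" and w2: "integrable (disc R) (\<lambda>x. (w x)\<^sup>2)"
    using v w by (auto simp: L2_on_def)
  define g where "g = (\<lambda>p::(real^2) \<times> (real^2). 1 + \<bar>ln (norm (fst p - snd p))\<bar>)"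
  have [measurable]: "g \<in> borel_measurable (disc R \<Otimes>\<^sub>M disc R)"
    unfolding g_def by (rule borel_measurable_disc_pair) measurable
  have gC: "(\<integral>\<^sup>+y. ennreal (g (x, y)) \<partial>disc R) \<le> ennreal C"
           "(\<integral>\<^sup>+y. ennreal (g (y, x)) \<partial>disc R) \<le> ennreal C" if "x \<in> ball 0 R" for x
    using C(2)[OF that] by (auto simp: g_def norm_minus_commute)
  have bound: "(\<integral>\<^sup>+x. ennreal ((u x)\<^sup>2) * ennreal C \<partial>disc R) < \<infinity>"
    if "integrable (disc R) (\<lambda>x. (u x)\<^sup>2)" for u
    using that by (subst nn_integral_multc) (auto simp: integrable_iff_bounded ennreal_mult_less_top)
  have g_meas1: "(\<lambda>y. g (x, y)) \<in> borel_measurable (disc R)" if "x \<in> space (disc R)" for x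
    using that by measurable
  have g_meas2: "(\<lambda>y. g (y, x)) \<in> borel_measurable (disc R)" if "x \<in> space (disc R)" for x
    using that by measurable
  have "(\<integral>\<^sup>+p. ennreal ((v (fst p))\<^sup>2) * ennreal (g p) \<partial>(disc R \<Otimes>\<^sub>M disc R))
      = (\<integral>\<^sup>+x. \<integral>\<^sup>+y. ennreal ((v x)\<^sup>2) * ennreal (g (x, y)) \<partial>disc R \<partial>disc R)"
    by (subst disc.nn_integral_fst[symmetric]) auto
  also have "\<dots> = (\<integral>\<^sup>+x. ennreal ((v x)\<^sup>2) * (\<integral>\<^sup>+y. ennreal (g (x, y)) \<partial>disc R) \<partial>disc R)"
    by (intro nn_integral_cong nn_integral_cmult) (use g_meas1 in auto)
  also have "\<dots> \<le> (\<integral>\<^sup>+x. ennreal ((v x)\<^sup>2) * ennreal C \<partial>disc R)"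
    by (intro nn_integral_mono mult_left_mono gC) auto
  finally have 1: "(\<integral>\<^sup>+p. ennreal ((v (fst p))\<^sup>2) * ennreal (g p) \<partial>(disc R \<Otimes>\<^sub>M disc R)) < \<infinity>"
    using bound[OF v2] by (rule order.strict_trans1)
  have "(\<integral>\<^sup>+p. ennreal ((w (snd p))\<^sup>2) * ennreal (g p) \<partial>(disc R \<Otimes>\<^sub>M disc R))
      = (\<integral>\<^sup>+x. \<integral>\<^sup>+y. ennreal ((w x)\<^sup>2) * ennreal (g (y, x)) \<partial>disc R \<partial>disc R)"
    by (subst disc_pair.nn_integral_snd[symmetric]) auto
  also have "\<dots> = (\<integral>\<^sup>+x. ennreal ((w x)\<^sup>2) * (\<integral>\<^sup>+y. ennreal (g (y, x)) \<partial>disc R) \<partial>disc R)"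
    by (intro nn_integral_cong nn_integral_cmult) (use g_meas2 in auto)
  also have "\<dots> \<le> (\<integral>\<^sup>+x. ennreal ((w x)\<^sup>2) * ennreal C \<partial>disc R)"
    by (intro nn_integral_mono mult_left_mono gC) auto
  finally have 2: "(\<integral>\<^sup>+p. ennreal ((w (snd p))\<^sup>2) * ennreal (g p) \<partial>(disc R \<Otimes>\<^sub>M disc R)) < \<infinity>"
    using bound[OF w2] by (rule order.strict_trans1)
  have "integrable (disc R \<Otimes>\<^sub>M disc R) (\<lambda>p. g p * (v (fst p) * w (snd p)))"
  proof (rule integrableI_bounded)
    have "(\<integral>\<^sup>+p. ennreal (norm (g p * (v (fst p) * w (snd p)))) \<partial>(disc R \<Otimes>\<^sub>M disc R))
        \<le> (\<integral>\<^sup>+p. ennreal ((v (fst p))\<^sup>2) * ennreal (g p) + ennreal ((w (snd p))\<^sup>2) * ennreal (g p)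
            \<partial>(disc R \<Otimes>\<^sub>M disc R))"
    proof (rule nn_integral_mono)
      fix p
      have g0: "0 \<le> g p" by (simp add: g_def)
      have "norm (g p * (v (fst p) * w (snd p))) \<le> ((v (fst p))\<^sup>2 + (w (snd p))\<^sup>2) * g p"
        using mult_left_mono[OF abs_mult_le_sum_squares g0] g0 by (simp add: abs_mult mult.commute)
      then show "ennreal (norm (g p * (v (fst p) * w (snd p))))
          \<le> ennreal ((v (fst p))\<^sup>2) * ennreal (g p) + ennreal ((w (snd p))\<^sup>2) * ennreal (g p)"
        using g0 by (simp add: ennreal_mult[symmetric] ennreal_plus[symmetric] distrib_right ennreal_leI del: ennreal_plus)
    qed
    also have "\<dots> < \<infinity>" using 1 2 by (subst nn_integral_add) auto
    finally show "(\<integral>\<^sup>+p. ennreal (norm (g p * (v (fst p) * w (snd p)))) \<partial>(disc R \<Otimes>\<^sub>M disc R)) < \<infinity>" .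
  qed measurable
  then show ?thesis by (simp add: g_def)
qed

lemma AE_disc_neq: "AE y in disc R. x \<noteq> y"
proof -
  have "AE y in lborel. x \<noteq> y" by (rule AE_I'[of "{x}"]) auto
  then show ?thesis
    by (subst AE_restrict_space_iff) (auto intro!: AE_completion elim!: eventually_mono)
qed

lemma AE_disc_pair_distinct: "AE p in disc R \<Otimes>\<^sub>M disc R. fst p \<noteq> snd p"
proof (rule disc_pair.AE_pair_measure)
  have "(\<lambda>p. norm (fst p - snd p)) \<in> borel_measurable (disc R \<Otimes>\<^sub>M disc R)"
    by (rule borel_measurable_disc_pair) measurable
  then have "{p \<in> space (disc R \<Otimes>\<^sub>M disc R). norm (fst p - snd p) \<noteq> 0} \<in> sets (disc R \<Otimes>\<^sub>M disc R)"
    by measurable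
  then show "{p \<in> space (disc R \<Otimes>\<^sub>M disc R). fst p \<noteq> snd p} \<in> sets (disc R \<Otimes>\<^sub>M disc R)" by simp
  show "AE x in disc R. AE y in disc R. fst (x, y) \<noteq> snd (x, y)" by (simp add: AE_disc_neq)
qed

section \<open>Positive semidefinite kernels of minimum type\<close>

text \<open>Writing the minimum as \<open>\<integral>t\<ge>0. [t < g x] [t < g y]\<close> and exchanging integrals, the double
integral becomes \<open>\<integral>t\<ge>0. (\<integral>x. a x [t < g x])\<^sup>2\<close>.\<close>

lemma layer_cake_kernel_nonneg:
  fixes a g :: "'a \<Rightarrow> real"
  assumes "sigma_finite_measure M"
    and [measurable]: "a \<in> borel_measurable M" "g \<in> borel_measurable M"
    and g0: "\<And>x. x \<in> space M \<Longrightarrow> 0 \<le> g x"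
    and int: "integrable (M \<Otimes>\<^sub>M M) (\<lambda>p. a (fst p) * a (snd p) * min (g (fst p)) (g (snd p)))"
  shows "0 \<le> (LINT p|(M \<Otimes>\<^sub>M M). a (fst p) * a (snd p) * min (g (fst p)) (g (snd p)))"
proof -
  interpret sigma_finite_measure M by fact
  interpret MM: pair_sigma_finite M M ..
  interpret P: sigma_finite_measure "M \<Otimes>\<^sub>M M" by (rule MM.sigma_finite_measure_axioms)
  interpret T: pair_sigma_finite "M \<Otimes>\<^sub>M M" "lborel :: real measure" ..
  define m where "m p = min (g (fst p)) (g (snd p))" for p
  define h where "h p t = a (fst p) * a (snd p) * indicator {0..<m p} t" for p and t :: real
  have [measurable]: "m \<in> borel_measurable (M \<Otimes>\<^sub>M M)" unfolding m_def by measurable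
  have h_alt: "h p t = a (fst p) * a (snd p) * (if 0 \<le> t \<and> t < m p then 1 else 0)" for p t
    by (simp add: h_def indicator_def)
  have hm [measurable]: "case_prod h \<in> borel_measurable ((M \<Otimes>\<^sub>M M) \<Otimes>\<^sub>M lborel)"
    unfolding h_alt by measurable
  have m0: "0 \<le> m p" if "p \<in> space (M \<Otimes>\<^sub>M M)" for p
    using that g0 by (auto simp: m_def space_pair_measure)
  have fiber: "(LINT t|lborel. c * indicator {0..<m p} t) = c * m p" if "p \<in> space (M \<Otimes>\<^sub>M M)" for c p
    using m0[OF that] by simp
  have h_int: "integrable ((M \<Otimes>\<^sub>M M) \<Otimes>\<^sub>M lborel) (case_prod h)"
  proof (rule T.Fubini_integrable)
    have "(LINT t|lborel. norm (case_prod h (p, t))) = norm (a (fst p) * a (snd p) * m p)"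
      if "p \<in> space (M \<Otimes>\<^sub>M M)" for p
      using fiber[OF that, of "\<bar>a (fst p) * a (snd p)\<bar>"] m0[OF that] by (simp add: h_def abs_mult)
    then show "integrable (M \<Otimes>\<^sub>M M) (\<lambda>p. LINT t|lborel. norm (case_prod h (p, t)))"
      using integrable_norm[OF int] by (subst Bochner_Integration.integrable_cong[OF refl]) (auto simp: m_def)
    show "AE p in M \<Otimes>\<^sub>M M. integrable lborel (\<lambda>t. case_prod h (p, t))"
    proof (rule AE_I2)
      fix p assume "p \<in> space (M \<Otimes>\<^sub>M M)"
      then have "emeasure lborel {0..<m p} < \<infinity>" using m0 by simp
      then have "integrable lborel (indicat_real {0..<m p})"
        by (intro integrable_real_indicator) auto
      then show "integrable lborel (\<lambda>t. case_prod h (p, t))" by (simp add: h_def)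
    qed
  qed (fact hm)
  have "0 \<le> (LINT p|(M \<Otimes>\<^sub>M M). h p t)" for t
  proof (cases "integrable (M \<Otimes>\<^sub>M M) (\<lambda>p. h p t)")
    case True
    define b where "b x = a x * (if 0 \<le> t \<and> t < g x then 1 else 0)" for x
    have h_b: "h p t = b (fst p) * b (snd p)" for p
      by (auto simp: h_alt b_def m_def)
    have "(LINT p|(M \<Otimes>\<^sub>M M). h p t) = (LINT x|M. LINT y|M. b x * b y)"
      using MM.integral_fst'[OF True] by (simp add: h_b)
    also have "\<dots> = (LINT x|M. b x)\<^sup>2" by (simp add: power2_eq_square)
    finally show ?thesis by simp
  qed (simp add: not_integrable_integral_eq)
  then have "0 \<le> (LINT t|lborel. LINT p|(M \<Otimes>\<^sub>M M). h p t)" by (simp add: integral_nonneg_AE)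
  also have "\<dots> = (LINT p|(M \<Otimes>\<^sub>M M). LINT t|lborel. h p t)"
    using T.Fubini_integral[OF h_int] .
  also have "\<dots> = (LINT p|(M \<Otimes>\<^sub>M M). a (fst p) * a (snd p) * m p)"
    by (intro Bochner_Integration.integral_cong refl) (unfold h_def, rule fiber)
  finally show ?thesis by (simp add: m_def)
qed

section \<open>Expansion of the logarithmic kernel\<close>

text \<open>With \<open>x = r e^(i \<alpha>)\<close> and \<open>y = \<rho> e^(i \<beta>)\<close> this is \<open>(min r \<rho> / max r \<rho>) e^(i (\<alpha> - \<beta>))\<close>, the variable
of the classical expansion of \<open>ln |x - y|\<close>. At \<open>x = y = 0\<close> it is 0.\<close>

definition kernel_ratio :: "real^2 \<Rightarrow> real^2 \<Rightarrow> complex" where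
  "kernel_ratio x y = plane_complex x * cnj (plane_complex y) / of_real ((max (norm x) (norm y))\<^sup>2)"

lemma norm_kernel_ratio_le: "cmod (kernel_ratio x y) \<le> 1"
proof -
  have "norm x * norm y \<le> max (norm x) (norm y) * max (norm x) (norm y)"
    by (intro mult_mono) (auto simp: le_max_iff_disj)
  then show ?thesis
    by (simp add: kernel_ratio_def norm_mult norm_divide norm_power power2_eq_square divide_le_eq_1)
       (smt (verit) norm_ge_zero zero_less_mult_iff mult_nonneg_nonneg)
qed

text \<open>If \<open>|x|\<close> is the larger norm then \<open>1 - x cnj(y) / |x|\<^sup>2 = cnj (x - y) / cnj x\<close>; the other case is
conjugate to this one.\<close>

lemma norm_1_minus_kernel_ratio:
  assumes "x \<noteq> y"
  shows "cmod (1 - kernel_ratio x y) = norm (x - y) / max (norm x) (norm y)"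
proof -
  have *: "cmod (1 - plane_complex u * cnj (plane_complex v) / of_real ((norm u)\<^sup>2)) = norm (u - v) / norm u"
    if "u \<noteq> 0" for u v
  proof -
    let ?u = "plane_complex u" and ?v = "plane_complex v"
    have u2: "complex_of_real ((norm u)\<^sup>2) = ?u * cnj ?u"
      using complex_norm_square[of ?u] by simp
    have "1 - ?u * cnj ?v / of_real ((norm u)\<^sup>2) = cnj (?u - ?v) / cnj ?u"
      unfolding u2 using that by (simp add: field_simps)
    then have "cmod (1 - ?u * cnj ?v / of_real ((norm u)\<^sup>2)) = cmod (plane_complex (u - v)) / cmod ?u"
      by (simp only: norm_divide complex_mod_cnj plane_complex_diff)
    then show ?thesis by simp
  qed
  show ?thesis
  proof (cases "norm y \<le> norm x")
    case True
    with assms have "x \<noteq> 0" by auto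
    with *[of x y] True show ?thesis by (simp add: kernel_ratio_def max_def)
  next
    case False
    then have "y \<noteq> 0" "max (norm x) (norm y) = norm y" by auto
    moreover have "cmod (1 - kernel_ratio x y) = cmod (cnj (1 - kernel_ratio x y))"
      by (simp only: complex_mod_cnj)
    ultimately show ?thesis using *[of y x]
      by (simp add: kernel_ratio_def norm_minus_commute mult.commute del: complex_mod_cnj)
  qed
qed

lemma borel_measurable_kernel_ratio [measurable]:
  "(\<lambda>p. kernel_ratio (fst p) (snd p)) \<in> borel_measurable (borel \<Otimes>\<^sub>M borel)"
proof -
  have [measurable]: "cnj \<in> borel_measurable borel"
    by (intro borel_measurable_continuous_onI continuous_intros)
  show ?thesis unfolding kernel_ratio_def by measurable
qed

lemma sums_Re_log_series:
  assumes "cmod z < 1"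
  shows "(\<lambda>k. Re (z ^ k) / real k) sums (- ln (cmod (1 - z)))"
proof -
  have "z \<noteq> 1" using assms by auto
  have "(\<lambda>k. - (z ^ k / of_nat k)) sums Ln (1 - z)"
    using Ln_series'[of "- z"] assms by simp
  from sums_Re[OF this] have "(\<lambda>k. - Re (z ^ k / of_nat k)) sums ln (cmod (1 - z))"
    using \<open>z \<noteq> 1\<close> by simp
  from sums_minus[OF this] show ?thesis by simp
qed

text \<open>Makes the logarithm of the damped kernel bounded by that of the undamped one up to a
constant, uniformly in \<open>s\<close>.\<close>

lemma norm_1_minus_scaled_ge:
  assumes "cmod z \<le> 1" "0 \<le> s" "s \<le> 1"
  shows "cmod (1 - z) / 2 \<le> cmod (1 - of_real s * z)"
proof -
  have "cmod (1 - z) \<le> cmod (1 - of_real s * z) + cmod (of_real (s - 1) * z)"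
    using norm_triangle_ineq[of "1 - of_real s * z" "of_real (s - 1) * z"] by (simp add: algebra_simps)
  also have "cmod (of_real (s - 1) * z) \<le> 1 - s"
    using assms by (simp add: norm_mult mult_left_le del: of_real_diff)
  also have "1 - s \<le> cmod (1 - of_real s * z)"
  proof -
    have "cmod (of_real s * z) \<le> s" using assms by (simp add: norm_mult mult_left_le)
    moreover have "1 - cmod (of_real s * z) \<le> cmod (1 - of_real s * z)"
      using norm_triangle_ineq2[of 1 "of_real s * z"] by simp
    ultimately show ?thesis by linarith
  qed
  finally show ?thesis by simp
qed

lemma integrable_kernel:
  assumes v: "v \<in> L2_on (ball 0 R)" and w: "w \<in> L2_on (ball 0 R)"
    and g: "g \<in> borel_measurable (borel \<Otimes>\<^sub>M borel)"
    and bound: "\<And>x y. x \<in> ball 0 R \<Longrightarrow> y \<in> ball 0 R \<Longrightarrow> x \<noteq> y \<Longrightarrow>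
                  \<bar>g (x, y)\<bar> \<le> C * (1 + \<bar>ln (norm (x - y))\<bar>)"
  shows "integrable (disc R \<Otimes>\<^sub>M disc R) (\<lambda>p. g p * (v (fst p) * w (snd p)))"
proof (rule Bochner_Integration.integrable_bound)
  show "integrable (disc R \<Otimes>\<^sub>M disc R)
          (\<lambda>p. C * ((1 + \<bar>ln (norm (fst p - snd p))\<bar>) * (v (fst p) * w (snd p))))"
    by (intro integrable_mult_right integrable_log_kernel v w)
  have [measurable]: "v \<in> borel_measurable (disc R)" "w \<in> borel_measurable (disc R)"
    using v w by (auto simp: L2_on_def)
  have [measurable]: "g \<in> borel_measurable (disc R \<Otimes>\<^sub>M disc R)"
    by (rule borel_measurable_disc_pair) (fact g)
  show "(\<lambda>p. g p * (v (fst p) * w (snd p))) \<in> borel_measurable (disc R \<Otimes>\<^sub>M disc R)"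
    by measurable
  show "AE p in disc R \<Otimes>\<^sub>M disc R. norm (g p * (v (fst p) * w (snd p)))
          \<le> norm (C * ((1 + \<bar>ln (norm (fst p - snd p))\<bar>) * (v (fst p) * w (snd p))))"
    using AE_disc_pair_distinct AE_space
  proof eventually_elim
    case (elim p)
    have "\<bar>g p\<bar> \<le> C * (1 + \<bar>ln (norm (fst p - snd p))\<bar>)"
      using bound[of "fst p" "snd p"] elim by (auto simp: space_pair_measure)
    also have "\<dots> \<le> \<bar>C * (1 + \<bar>ln (norm (fst p - snd p))\<bar>)\<bar>" by simp
    finally have "\<bar>g p\<bar> * \<bar>v (fst p) * w (snd p)\<bar>
        \<le> \<bar>C * (1 + \<bar>ln (norm (fst p - snd p))\<bar>)\<bar> * \<bar>v (fst p) * w (snd p)\<bar>"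
      by (intro mult_right_mono) auto
    then show ?case by (simp only: real_norm_def abs_mult mult.assoc)
  qed
qed

text \<open>Both estimates come from \<open>|x - y| \<le> 2 max |x| |y|\<close>, which bounds \<open>ln (max |x| |y|)\<close> from below
by \<open>ln |x - y| - 1\<close>, while \<open>R\<close> bounds it from above.\<close>

lemma max_kernel_bound:
  fixes x y :: "real^2"
  assumes "x \<in> ball 0 R" "y \<in> ball 0 R" "x \<noteq> y"
  shows "\<bar>ln (R / max (norm x) (norm y))\<bar> \<le> (1 + \<bar>ln R\<bar>) * (1 + \<bar>ln (norm (x - y))\<bar>)"
    and "0 \<le> s \<Longrightarrow> s \<le> 1 \<Longrightarrow> \<bar>ln (cmod (1 - of_real s * kernel_ratio x y))\<bar>
           \<le> (1 + \<bar>ln R\<bar>) * (1 + \<bar>ln (norm (x - y))\<bar>)"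
proof -
  define m where "m = max (norm x) (norm y)"
  define d where "d = norm (x - y)"
  have d: "0 < d" using assms by (simp add: d_def)
  have "norm x \<le> m" "norm y \<le> m" by (auto simp: m_def)
  then have dm: "d \<le> 2 * m"
    using norm_triangle_ineq4[of x y] unfolding d_def by linarith
  have m: "0 < m" "m < R" using d dm assms by (auto simp: m_def)
  have "ln d \<le> ln 2 + ln m" 
  proof -
    have "ln d \<le> ln (2 * m)" using d dm by simp
    also have "\<dots> = ln 2 + ln m" using m by (simp add: ln_mult)
    finally show ?thesis .
  qed
  moreover have "ln m \<le> ln R" using m by simp
  moreover have ln2: "ln 2 \<le> (1::real)" using ln_le_minus_one[of "2::real"] by simp
  ultimately have lnm: "ln d - 1 \<le> ln m" "ln m \<le> ln R" by linarith+
  have absorb: "1 + \<bar>ln R\<bar> + \<bar>ln d\<bar> \<le> (1 + \<bar>ln R\<bar>) * (1 + \<bar>ln d\<bar>)"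
    by (simp add: algebra_simps)
  have "ln (R / m) = ln R - ln m" using m by (simp add: ln_div)
  then have "\<bar>ln (R / m)\<bar> \<le> 1 + \<bar>ln R\<bar> + \<bar>ln d\<bar>" using lnm by linarith
  also note absorb
  finally show "\<bar>ln (R / max (norm x) (norm y))\<bar> \<le> (1 + \<bar>ln R\<bar>) * (1 + \<bar>ln (norm (x - y))\<bar>)"
    by (simp add: m_def d_def)
  assume s: "0 \<le> s" "s \<le> 1"
  define q where "q = cmod (1 - of_real s * kernel_ratio x y)"
  have "d / m / 2 \<le> q"
    using norm_1_minus_scaled_ge[OF norm_kernel_ratio_le s, of x y] norm_1_minus_kernel_ratio[OF assms(3)]
    by (simp add: q_def d_def m_def)
  moreover have "0 < d / m / 2" using d m by simp
  ultimately have q: "0 < q" "ln (d / m / 2) \<le> ln q" by (auto intro: less_le_trans)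
  have "ln (d / m / 2) = ln d - ln m - ln 2" using d m by (simp add: ln_div ln_mult)
  moreover have "q \<le> 2"
  proof -
    have "cmod (of_real s * kernel_ratio x y) \<le> 1"
      using mult_le_one[of s "cmod (kernel_ratio x y)"] s norm_kernel_ratio_le[of x y] by (simp add: norm_mult)
    then show ?thesis using norm_triangle_ineq4[of 1 "of_real s * kernel_ratio x y"] by (simp add: q_def)
  qed
  then have "ln q \<le> ln 2" using q by simp
  ultimately have "\<bar>ln q\<bar> \<le> 1 + \<bar>ln R\<bar> + \<bar>ln d\<bar>" using q lnm ln2 by linarith
  also note absorb
  finally show "\<bar>ln (cmod (1 - of_real s * kernel_ratio x y))\<bar>
      \<le> (1 + \<bar>ln R\<bar>) * (1 + \<bar>ln (norm (x - y))\<bar>)"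
    by (simp add: q_def d_def)
qed

lemma integrable_kernel_ratio_power:
  assumes v: "v \<in> L2_on (ball 0 R)" and w: "w \<in> L2_on (ball 0 R)"
  shows "integrable (disc R \<Otimes>\<^sub>M disc R)
           (\<lambda>p. Re (kernel_ratio (fst p) (snd p) ^ k) * (v (fst p) * w (snd p)))"
proof (rule integrable_kernel[OF v w, where C = 1])
  fix x y :: "real^2"
  have "\<bar>Re (kernel_ratio x y ^ k)\<bar> \<le> cmod (kernel_ratio x y) ^ k"
    using abs_Re_le_cmod by (metis norm_power)
  also have "\<dots> \<le> 1" by (intro power_le_one norm_kernel_ratio_le) auto
  finally show "\<bar>Re (kernel_ratio (fst (x, y)) (snd (x, y)) ^ k)\<bar> \<le> 1 * (1 + \<bar>ln (norm (x - y))\<bar>)"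
    by simp
qed measurable

text \<open>Integrating the expansion term by term. Damping by \<open>s^k\<close> makes the series uniformly convergent
and keeps its coefficients nonnegative. The limit \<open>s \<rightarrow> 1\<close> then uses the domination by
\<open>1 + |ln |x - y||\<close>. Stating the result as an inequality for two functions serves both
applications: positivity, with \<open>v = w\<close>, and the vanishing of all terms for radial \<open>w\<close>.\<close>

lemma max_kernel_le_log_kernel:
  assumes v: "v \<in> L2_on (ball 0 R)" and w: "w \<in> L2_on (ball 0 R)"
    and pos: "\<And>k. 0 < k \<Longrightarrow>
      0 \<le> (LINT p|(disc R \<Otimes>\<^sub>M disc R). Re (kernel_ratio (fst p) (snd p) ^ k) * (v (fst p) * w (snd p)))"
  shows "(LINT p|(disc R \<Otimes>\<^sub>M disc R).
            ln (R / max (norm (fst p)) (norm (snd p))) * (v (fst p) * w (snd p)))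
       \<le> (LINT p|(disc R \<Otimes>\<^sub>M disc R). ln (R / norm (fst p - snd p)) * (v (fst p) * w (snd p)))"
proof -
  define z where "z p = kernel_ratio (fst p) (snd p)" for p
  define K0 where "K0 p = ln (R / max (norm (fst p)) (norm (snd p)))" for p :: "(real^2) \<times> (real^2)"
  define T where "T s n p = (\<Sum>k<n. Re ((of_real s * z p) ^ k) / real k)" for s :: real and n p
  define vw where "vw p = v (fst p) * w (snd p)" for p
  define H where "H p = 1 + \<bar>ln (norm (fst p - snd p))\<bar>" for p :: "(real^2) \<times> (real^2)"
  let ?P = "disc R \<Otimes>\<^sub>M disc R"
  let ?C = "1 + \<bar>ln R\<bar>"
  note int = integrable_kernel[OF v w, folded vw_def]
  have H_int: "integrable ?P (\<lambda>p. B * \<bar>H p * vw p\<bar>)" for B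
    using integrable_log_kernel[OF v w] unfolding H_def vw_def
    by (intro integrable_mult_right integrable_abs)
  have H1: "1 \<le> H p" for p by (simp add: H_def)
  have z_le: "cmod (z p) \<le> 1" for p by (simp add: z_def norm_kernel_ratio_le)
  have [measurable]: "z \<in> borel_measurable (borel \<Otimes>\<^sub>M borel)"
    unfolding z_def by (rule borel_measurable_kernel_ratio)
  have K0_meas [measurable]: "K0 \<in> borel_measurable (borel \<Otimes>\<^sub>M borel)"
    unfolding K0_def by measurable
  have K0_int: "integrable ?P (\<lambda>p. K0 p * vw p)"
    by (rule int[where C = ?C]) (auto simp: K0_def max_kernel_bound(1))
  have term_int: "integrable ?P (\<lambda>p. Re (z p ^ k) * vw p)" for k
    using integrable_kernel_ratio_power[OF v w] by (simp add: z_def vw_def)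
  have pair: "fst p \<in> ball 0 R" "snd p \<in> ball 0 R" if "p \<in> space ?P" for p
    using that by (auto simp: space_pair_measure)
  have mult_bound: "norm (g * vw p) \<le> B * \<bar>H p * vw p\<bar>" if "\<bar>g\<bar> \<le> B * H p" for g B p
  proof -
    have "\<bar>g\<bar> * \<bar>vw p\<bar> \<le> B * H p * \<bar>vw p\<bar>" using that by (intro mult_right_mono) auto
    then show ?thesis using H1[of p] by (simp add: abs_mult mult.assoc)
  qed
  have regularised: "(LINT p|?P. K0 p * vw p)
      \<le> (LINT p|?P. (K0 p - ln (cmod (1 - of_real s * z p))) * vw p)" if s: "0 \<le> s" "s < 1" for s
  proof (rule LIMSEQ_le_const)
    show "(\<lambda>n. LINT p|?P. (K0 p + T s n p) * vw p)
            \<longlonglongrightarrow> (LINT p|?P. (K0 p - ln (cmod (1 - of_real s * z p))) * vw p)"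
    proof (rule integral_dominated_convergence)
      show "integrable ?P (\<lambda>p. (?C + 1 / (1 - s)) * \<bar>H p * vw p\<bar>)" by (rule H_int)
      have [measurable]: "vw \<in> borel_measurable ?P"
        using v w unfolding vw_def L2_on_def by auto
      have [measurable]: "K0 \<in> borel_measurable ?P" "z \<in> borel_measurable ?P"
        by (intro borel_measurable_disc_pair; measurable)+
      show "(\<lambda>p. (K0 p - ln (cmod (1 - of_real s * z p))) * vw p) \<in> borel_measurable ?P"
        by measurable
      show "(\<lambda>p. (K0 p + T s n p) * vw p) \<in> borel_measurable ?P" for n
        unfolding T_def by measurable
      show "AE p in ?P. (\<lambda>n. (K0 p + T s n p) * vw p)
              \<longlonglongrightarrow> (K0 p - ln (cmod (1 - of_real s * z p))) * vw p"
      proof (rule AE_I2)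
        fix p
        have "cmod (of_real s * z p) \<le> s"
          using s z_le[of p] by (simp add: norm_mult mult_left_le)
        then have "cmod (of_real s * z p) < 1" using s by linarith
        from sums_Re_log_series[OF this]
        have "(\<lambda>n. T s n p) \<longlonglongrightarrow> - ln (cmod (1 - of_real s * z p))"
          by (simp add: sums_def T_def)
        then show "(\<lambda>n. (K0 p + T s n p) * vw p)
              \<longlonglongrightarrow> (K0 p - ln (cmod (1 - of_real s * z p))) * vw p"
          by (auto intro!: tendsto_eq_intros)
      qed
      fix n
      show "AE p in ?P. norm ((K0 p + T s n p) * vw p) \<le> (?C + 1 / (1 - s)) * \<bar>H p * vw p\<bar>"
        using AE_disc_pair_distinct AE_space
      proof eventually_elim
        case (elim p)
        have "\<bar>T s n p\<bar> \<le> (\<Sum>k<n. s ^ k)"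
          unfolding T_def
        proof (rule order.trans[OF sum_abs sum_mono])
          fix k
          have "\<bar>Re ((of_real s * z p) ^ k)\<bar> \<le> cmod ((of_real s * z p) ^ k)" by (rule abs_Re_le_cmod)
          also have "\<dots> = s ^ k * cmod (z p) ^ k"
            using s by (simp add: norm_power norm_mult power_mult_distrib)
          also have "\<dots> \<le> s ^ k * 1" using s z_le by (intro mult_left_mono power_le_one) auto
          finally have "\<bar>Re ((of_real s * z p) ^ k)\<bar> \<le> s ^ k" by simp
          moreover have "\<bar>b / real k\<bar> \<le> \<bar>b\<bar>" for b :: real
            using mult_right_mono[of 1 "real k" "\<bar>b\<bar>"] by (cases "k = 0") (auto simp: field_simps)
          from this[of "Re ((of_real s * z p) ^ k)"]
          have "\<bar>Re ((of_real s * z p) ^ k) / real k\<bar> \<le> \<bar>Re ((of_real s * z p) ^ k)\<bar>" .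
          ultimately show "\<bar>Re ((of_real s * z p) ^ k) / real k\<bar> \<le> s ^ k" by linarith
        qed
        also have "\<dots> \<le> 1 / (1 - s)"
          using s by (simp add: sum_gp_strict divide_right_mono)
        also have "\<dots> \<le> 1 / (1 - s) * H p"
          using s H1[of p] by (simp add: mult_le_cancel_left1 divide_le_cancel)
        finally have "\<bar>T s n p\<bar> \<le> 1 / (1 - s) * H p" .
        moreover have "\<bar>K0 p\<bar> \<le> ?C * H p"
          using max_kernel_bound(1) pair[of p] elim by (simp add: K0_def H_def)
        ultimately have "\<bar>K0 p + T s n p\<bar> \<le> (?C + 1 / (1 - s)) * H p"
          unfolding distrib_right by linarith
        then show ?case by (rule mult_bound)
      qed
    qed
    have "(LINT p|?P. K0 p * vw p) \<le> (LINT p|?P. (K0 p + T s n p) * vw p)" for n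
    proof -
      have eq: "(K0 p + T s n p) * vw p = K0 p * vw p + (\<Sum>k<n. s ^ k / real k * (Re (z p ^ k) * vw p))" for p
        by (simp add: T_def distrib_right sum_distrib_right power_mult_distrib mult.assoc flip: of_real_power)
      have "(LINT p|?P. (K0 p + T s n p) * vw p)
          = (LINT p|?P. K0 p * vw p) + (\<Sum>k<n. s ^ k / real k * (LINT p|?P. Re (z p ^ k) * vw p))"
        unfolding eq using K0_int term_int
        by (subst Bochner_Integration.integral_add) (auto intro!: Bochner_Integration.integrable_sum)
      moreover have "0 \<le> s ^ k / real k * (LINT p|?P. Re (z p ^ k) * vw p)" for k
        using s pos[of k] by (cases "k = 0") (auto simp: z_def vw_def)
      ultimately show ?thesis by (simp add: sum_nonneg)
    qed
    then show "\<exists>N. \<forall>n\<ge>N. (LINT p|?P. K0 p * vw p) \<le> (LINT p|?P. (K0 p + T s n p) * vw p)" by blast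
  qed
  define s where "s = (\<lambda>j. 1 - 1 / real (j + 2))"
  have s: "0 \<le> s j" "s j < 1" for j by (auto simp: s_def field_simps)
  have s_lim: "s \<longlonglongrightarrow> 1"
    using tendsto_diff[OF tendsto_const LIMSEQ_ignore_initial_segment[OF lim_1_over_n, of 2], of "1::real"]
    by (simp add: s_def)
  have "(LINT p|?P. K0 p * vw p) \<le> (LINT p|?P. ln (R / norm (fst p - snd p)) * vw p)"
  proof (rule LIMSEQ_le_const)
    show "\<exists>N. \<forall>j\<ge>N. (LINT p|?P. K0 p * vw p)
            \<le> (LINT p|?P. (K0 p - ln (cmod (1 - of_real (s j) * z p))) * vw p)"
      using regularised[OF s] by blast
    show "(\<lambda>j. LINT p|?P. (K0 p - ln (cmod (1 - of_real (s j) * z p))) * vw p)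
            \<longlonglongrightarrow> (LINT p|?P. ln (R / norm (fst p - snd p)) * vw p)"
    proof (rule integral_dominated_convergence)
      show "integrable ?P (\<lambda>p. (?C + ?C) * \<bar>H p * vw p\<bar>)" by (rule H_int)
      have [measurable]: "vw \<in> borel_measurable ?P"
        using v w unfolding vw_def L2_on_def by auto
      have [measurable]: "K0 \<in> borel_measurable ?P" "z \<in> borel_measurable ?P"
        by (intro borel_measurable_disc_pair; measurable)+
      have "(\<lambda>p. ln (R / norm (fst p - snd p))) \<in> borel_measurable ?P"
        by (rule borel_measurable_disc_pair) measurable
      then show "(\<lambda>p. ln (R / norm (fst p - snd p)) * vw p) \<in> borel_measurable ?P"
        by measurable
      show "(\<lambda>p. (K0 p - ln (cmod (1 - of_real (s j) * z p))) * vw p) \<in> borel_measurable ?P" for j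
        by measurable
      show "AE p in ?P. (\<lambda>j. (K0 p - ln (cmod (1 - of_real (s j) * z p))) * vw p)
              \<longlonglongrightarrow> ln (R / norm (fst p - snd p)) * vw p"
        using AE_disc_pair_distinct AE_space
      proof eventually_elim
        case (elim p)
        define m where "m = max (norm (fst p)) (norm (snd p))"
        have m: "0 < m" "0 < R"
          using elim pair[of p] by (auto simp: m_def less_max_iff_disj intro: le_less_trans[OF norm_ge_zero])
        have dist: "cmod (1 - z p) = norm (fst p - snd p) / m"
          unfolding z_def m_def by (rule norm_1_minus_kernel_ratio) (use elim in simp)
        have "z p \<noteq> 1" using dist elim m by auto
        have "K0 p - ln (cmod (1 - z p)) = ln (R / norm (fst p - snd p))"
          using m elim unfolding dist by (simp add: K0_def m_def[symmetric] ln_div)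
        moreover have "(\<lambda>j. (K0 p - ln (cmod (1 - of_real (s j) * z p))) * vw p)
              \<longlonglongrightarrow> (K0 p - ln (cmod (1 - of_real 1 * z p))) * vw p"
          using \<open>z p \<noteq> 1\<close> by (intro tendsto_intros s_lim) auto
        ultimately show ?case by simp
      qed
      fix j
      show "AE p in ?P. norm ((K0 p - ln (cmod (1 - of_real (s j) * z p))) * vw p)
              \<le> (?C + ?C) * \<bar>H p * vw p\<bar>"
        using AE_disc_pair_distinct AE_space
      proof eventually_elim
        case (elim p)
        have "\<bar>K0 p\<bar> \<le> ?C * H p" "\<bar>ln (cmod (1 - of_real (s j) * z p))\<bar> \<le> ?C * H p"
          using max_kernel_bound(1) max_kernel_bound(2)[of _ _ _ "s j"] pair[of p] elim s[of j] by (simp_all add: K0_def H_def z_def)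
        then have "\<bar>K0 p - ln (cmod (1 - of_real (s j) * z p))\<bar> \<le> (?C + ?C) * H p"
          unfolding distrib_right by linarith
        then show ?case by (rule mult_bound)
      qed
    qed
  qed
  then show ?thesis by (simp add: K0_def vw_def)
qed

section \<open>Positivity and action on radial functions\<close>

lemma AE_disc_pair_nonzero: "AE p in disc R \<Otimes>\<^sub>M disc R. fst p \<noteq> 0 \<and> snd p \<noteq> 0"
proof (rule disc_pair.AE_pair_measure)
  have [measurable]: "(\<lambda>p. norm (fst p)) \<in> borel_measurable (disc R \<Otimes>\<^sub>M disc R)"
    "(\<lambda>p. norm (snd p)) \<in> borel_measurable (disc R \<Otimes>\<^sub>M disc R)"
    by (rule borel_measurable_disc_pair; measurable)+
  have "{p \<in> space (disc R \<Otimes>\<^sub>M disc R). norm (fst p) \<noteq> 0 \<and> norm (snd p) \<noteq> 0}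
          \<in> sets (disc R \<Otimes>\<^sub>M disc R)"
    by measurable
  then show "{p \<in> space (disc R \<Otimes>\<^sub>M disc R). fst p \<noteq> 0 \<and> snd p \<noteq> 0} \<in> sets (disc R \<Otimes>\<^sub>M disc R)" by simp
  show "AE x in disc R. AE y in disc R. fst (x, y) \<noteq> 0 \<and> snd (x, y) \<noteq> 0"
    using AE_disc_neq[where x = 0 and R = R] by (auto elim!: eventually_mono)
qed

text \<open>\<open>Re (x^k cnj(y)^k)\<close> is a sum of two kernels \<open>a(x) a(y)\<close>, with \<open>a\<close> the real and the imaginary part
of the power, and \<open>1 / max |x| |y| ^ (2k)\<close> is a minimum; so the layer cake lemma applies to both.\<close>

lemma kernel_ratio_power_nonneg:
  assumes v: "v \<in> L2_on (ball 0 R)" and k: "0 < k"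
  shows "0 \<le> (LINT p|(disc R \<Otimes>\<^sub>M disc R). Re (kernel_ratio (fst p) (snd p) ^ k) * (v (fst p) * v (snd p)))"
proof -
  define g where "g x = 1 / norm x ^ (2 * k)" for x :: "real^2"
  have [measurable]: "g \<in> borel_measurable borel" unfolding g_def by measurable
  have [measurable]: "v \<in> borel_measurable (disc R)" using v by (simp add: L2_on_def)
  have [measurable]: "Re \<in> borel_measurable borel" "Im \<in> borel_measurable borel"
    by (intro borel_measurable_continuous_onI continuous_intros)+
  have g_nonneg: "0 \<le> g x" for x by (simp add: g_def)
  define G where "G c p = c (plane_complex (fst p) ^ k) * c (plane_complex (snd p) ^ k)
      * min (g (fst p)) (g (snd p))" for c :: "complex \<Rightarrow> real" and p
  have part: "integrable (disc R \<Otimes>\<^sub>M disc R) (\<lambda>p. G c p * (v (fst p) * v (snd p)))"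
      "0 \<le> (LINT p|(disc R \<Otimes>\<^sub>M disc R). G c p * (v (fst p) * v (snd p)))"
    if c [measurable]: "c \<in> borel_measurable borel" and c_le: "\<And>z. \<bar>c z\<bar> \<le> cmod z" for c
  proof -
    show int: "integrable (disc R \<Otimes>\<^sub>M disc R) (\<lambda>p. G c p * (v (fst p) * v (snd p)))"
    proof (rule integrable_kernel[OF v v, where C = 1])
      show "G c \<in> borel_measurable (borel \<Otimes>\<^sub>M borel)" unfolding G_def by measurable
      fix x y :: "real^2"
      define a where "a = norm x ^ k"
      define b where "b = norm y ^ k"
      have ab: "0 \<le> a" "0 \<le> b" by (auto simp: a_def b_def)
      have g: "g x = (1 / a) * (1 / a)" "g y = (1 / b) * (1 / b)"
        by (simp_all add: g_def a_def b_def mult_2 power_add)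
      have min_le: "min (g x) (g y) \<le> (1 / a) * (1 / b)"
      proof (cases "1 / a \<le> 1 / b")
        case True
        then have "g x \<le> (1 / a) * (1 / b)" unfolding g using ab by (intro mult_left_mono) auto
        then show ?thesis by (rule min.coboundedI1)
      next
        case False
        then have "g y \<le> (1 / a) * (1 / b)" unfolding g using ab by (intro mult_right_mono) auto
        then show ?thesis by (rule min.coboundedI2)
      qed
      have g0: "0 \<le> min (g x) (g y)" by (simp add: g_def)
      have ca: "\<bar>c (plane_complex x ^ k)\<bar> \<le> a" "\<bar>c (plane_complex y ^ k)\<bar> \<le> b"
        using c_le[of "plane_complex x ^ k"] c_le[of "plane_complex y ^ k"]
        by (simp_all add: a_def b_def norm_power)
      have "\<bar>G c (x, y)\<bar> = \<bar>c (plane_complex x ^ k)\<bar> * \<bar>c (plane_complex y ^ k)\<bar> * min (g x) (g y)"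
        using g0 by (simp add: G_def abs_mult)
      also have "\<dots> \<le> a * b * ((1 / a) * (1 / b))"
        by (intro mult_mono ca min_le g0) (use ab in auto)
      also have "\<dots> \<le> 1" by (cases "a = 0 \<or> b = 0") auto
      finally show "\<bar>G c (x, y)\<bar> \<le> 1 * (1 + \<bar>ln (norm (x - y))\<bar>)" by simp
    qed
    have [measurable]: "g \<in> borel_measurable (disc R)" "(\<lambda>x. c (plane_complex x ^ k)) \<in> borel_measurable (disc R)"
      by (rule borel_measurable_disc; measurable)+
    have eq: "G c p * (v (fst p) * v (snd p)) = (v (fst p) * c (plane_complex (fst p) ^ k))
        * (v (snd p) * c (plane_complex (snd p) ^ k)) * min (g (fst p)) (g (snd p))" for p
      by (simp add: G_def ac_simps)
    show "0 \<le> (LINT p|(disc R \<Otimes>\<^sub>M disc R). G c p * (v (fst p) * v (snd p)))"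
      using int unfolding eq
      by (intro layer_cake_kernel_nonneg) (auto simp: g_nonneg disc.sigma_finite_measure_axioms)
  qed
  have split: "Re (kernel_ratio (fst p) (snd p) ^ k) = G Re p + G Im p" for p
  proof (cases "fst p = 0 \<or> snd p = 0")
    \<comment> \<open>Here \<open>g\<close> takes the value 0 at the origin, but both sides vanish because \<open>k > 0\<close>.\<close>
    case True
    then have z: "plane_complex (fst p) = 0 \<or> plane_complex (snd p) = 0" by simp
    then have "kernel_ratio (fst p) (snd p) = 0" by (auto simp: kernel_ratio_def)
    with z show ?thesis using k by (auto simp: G_def)
  next
    case False
    have "min (g (fst p)) (g (snd p)) = 1 / max (norm (fst p)) (norm (snd p)) ^ (2 * k)"
      using False by (auto simp: g_def min_def max_def divide_simps power_mono not_le
           intro!: antisym dest: power_strict_mono[of _ _ "2 * k"])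
    moreover have "kernel_ratio (fst p) (snd p) ^ k
        = plane_complex (fst p) ^ k * cnj (plane_complex (snd p) ^ k)
            / of_real (max (norm (fst p)) (norm (snd p)) ^ (2 * k))"
      by (simp add: kernel_ratio_def power_divide power_mult_distrib power_mult)
    ultimately show ?thesis
      by (simp only: G_def Re_divide_of_real) (simp add: add_divide_distrib del: complex_cnj_power)
  qed
  have Re_Im: "\<bar>Re z\<bar> \<le> cmod z" "\<bar>Im z\<bar> \<le> cmod z" for z
    by (auto simp: abs_Re_le_cmod abs_Im_le_cmod)
  show ?thesis unfolding split distrib_right
    using part[of Re] part[of Im] Re_Im by (subst Bochner_Integration.integral_add) auto
qed

lemma max_kernel_nonneg:
  assumes v: "v \<in> L2_on (ball 0 R)"
  shows "0 \<le> (LINT p|(disc R \<Otimes>\<^sub>M disc R).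
            ln (R / max (norm (fst p)) (norm (snd p))) * (v (fst p) * v (snd p)))"
proof -
  define g where "g x = ln (R / norm x)" for x :: "real^2"
  have [measurable]: "g \<in> borel_measurable (disc R)"
    by (rule borel_measurable_disc) (unfold g_def, measurable)
  have [measurable]: "v \<in> borel_measurable (disc R)" using v by (simp add: L2_on_def)
  have K0_int: "integrable (disc R \<Otimes>\<^sub>M disc R)
      (\<lambda>p. ln (R / max (norm (fst p)) (norm (snd p))) * (v (fst p) * v (snd p)))"
    by (rule integrable_kernel[OF v v, where C = "1 + \<bar>ln R\<bar>"]) (auto simp: max_kernel_bound(1))
  have ae: "AE p in disc R \<Otimes>\<^sub>M disc R.
      ln (R / max (norm (fst p)) (norm (snd p))) * (v (fst p) * v (snd p))
        = v (fst p) * v (snd p) * min (g (fst p)) (g (snd p))"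
    using AE_disc_pair_nonzero AE_space
  proof eventually_elim
    case (elim p)
    then have "norm (fst p) < R" by (auto simp: space_pair_measure)
    then have R: "0 < R" using norm_ge_zero[of "fst p"] by linarith
    have "g x \<le> g y \<longleftrightarrow> norm y \<le> norm x" if "x \<noteq> 0" "y \<noteq> 0" for x y
      using that R by (simp add: g_def divide_simps)
    then have "min (g (fst p)) (g (snd p)) = ln (R / max (norm (fst p)) (norm (snd p)))"
      using elim by (auto simp: min_def max_def g_def)
    then show ?case by simp
  qed
  have int: "integrable (disc R \<Otimes>\<^sub>M disc R) (\<lambda>p. v (fst p) * v (snd p) * min (g (fst p)) (g (snd p)))"
    using K0_int by (rule integrable_cong_AE_imp) (use ae in \<open>auto elim!: eventually_mono\<close>)
  have g0: "0 \<le> g x" if "x \<in> space (disc R)" for x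
  proof (cases "x = 0")
    case False
    then show ?thesis using that by (auto simp: g_def)
  qed (simp add: g_def)
  have "0 \<le> (LINT p|(disc R \<Otimes>\<^sub>M disc R). v (fst p) * v (snd p) * min (g (fst p)) (g (snd p)))"
    by (rule layer_cake_kernel_nonneg) (use int g0 disc.sigma_finite_measure_axioms in auto)
  also have "\<dots> = (LINT p|(disc R \<Otimes>\<^sub>M disc R).
            ln (R / max (norm (fst p)) (norm (snd p))) * (v (fst p) * v (snd p)))"
    using ae K0_int int by (intro integral_cong_AE) (auto elim!: eventually_mono)
  finally show ?thesis .
qed

definition log_form :: "real \<Rightarrow> (real^2 \<Rightarrow> real) \<Rightarrow> (real^2 \<Rightarrow> real) \<Rightarrow> real" where
  "log_form R v w
     = (LINT p|(disc R \<Otimes>\<^sub>M disc R). ln (R / norm (fst p - snd p)) * (v (fst p) * w (snd p)))"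

lemma log_form_nonneg:
  assumes "v \<in> L2_on (ball 0 R)"
  shows "0 \<le> log_form R v v"
  unfolding log_form_def
  using max_kernel_nonneg[OF assms] max_kernel_le_log_kernel[OF assms assms kernel_ratio_power_nonneg[OF assms]]
  by (rule order.trans)

text \<open>Rotating \<open>y\<close> by \<open>\<pi> / k\<close> multiplies the \<open>k\<close>-th power of the ratio by \<open>-1\<close> and leaves a radial
factor unchanged, so the integral over \<open>y\<close> vanishes for every \<open>x\<close>.\<close>

lemma kernel_ratio_power_radial:
  assumes v: "v \<in> L2_on (ball 0 R)" and w: "(\<lambda>y. f (norm y)) \<in> L2_on (ball 0 R)"
    and [measurable]: "f \<in> borel_measurable borel" and k: "0 < k"
  shows "(LINT p|(disc R \<Otimes>\<^sub>M disc R). Re (kernel_ratio (fst p) (snd p) ^ k) * (v (fst p) * f (norm (snd p)))) = 0"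
proof -
  have inner: "(LINT y|disc R. Re (kernel_ratio x y ^ k) * f (norm y)) = 0" for x
  proof -
    have rot: "kernel_ratio x (rotation (pi / k) y) ^ k = - (kernel_ratio x y ^ k)" for y
    proof -
      have "kernel_ratio x (rotation (pi / k) y) = cis (- (pi / k)) * kernel_ratio x y"
        by (simp add: kernel_ratio_def plane_complex_rotation flip: cis_cnj)
      moreover have "cis (- (pi / k)) ^ k = - 1"
        using k by (simp only: Complex.DeMoivre) (simp add: complex_eq_iff)
      ultimately show ?thesis by (simp add: power_mult_distrib)
    qed
    have [measurable]: "(\<lambda>y. kernel_ratio x y) \<in> borel_measurable borel"
    proof -
      have "(\<lambda>y. (x, y)) \<in> borel \<rightarrow>\<^sub>M borel \<Otimes>\<^sub>M (borel :: (real^2) measure)"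
        by (rule measurable_Pair1') simp
      from measurable_compose[OF this borel_measurable_kernel_ratio] show ?thesis by simp
    qed
    have [measurable]: "Re \<in> borel_measurable borel"
      by (intro borel_measurable_continuous_onI continuous_intros)
    have "(LINT y|disc R. Re (kernel_ratio x y ^ k) * f (norm y))
        = (LINT y|disc R. Re (kernel_ratio x (rotation (pi / k) y) ^ k) * f (norm (rotation (pi / k) y)))"
      by (rule integral_disc_rotation[symmetric]) measurable
    also have "\<dots> = - (LINT y|disc R. Re (kernel_ratio x y ^ k) * f (norm y))"
      by (simp add: rot)
    finally show ?thesis by simp
  qed
  have "(LINT p|(disc R \<Otimes>\<^sub>M disc R). Re (kernel_ratio (fst p) (snd p) ^ k) * (v (fst p) * f (norm (snd p))))
      = (LINT x|disc R. LINT y|disc R. v x * (Re (kernel_ratio x y ^ k) * f (norm y)))"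
    using disc_pair.integral_fst'[OF integrable_kernel_ratio_power[OF v w, of k]]
    by (simp add: mult.left_commute)
  also have "\<dots> = 0" by (simp only: integral_mult_right_zero inner mult_zero_right Bochner_Integration.integral_zero)
  finally show ?thesis .
qed

text \<open>Newton's theorem in the plane: a radial charge distribution acts through
\<open>ln (R / max |x| |y|)\<close> only. The reverse inequality comes from replacing \<open>v\<close> by \<open>- v\<close>.\<close>

lemma log_form_radial:
  assumes v: "v \<in> L2_on (ball 0 R)" and w: "(\<lambda>y. f (norm y)) \<in> L2_on (ball 0 R)"
    and f: "f \<in> borel_measurable borel"
  shows "log_form R v (\<lambda>y. f (norm y))
    = (LINT p|(disc R \<Otimes>\<^sub>M disc R).
         ln (R / max (norm (fst p)) (norm (snd p))) * (v (fst p) * f (norm (snd p))))"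
proof (rule antisym)
  show "(LINT p|(disc R \<Otimes>\<^sub>M disc R).
         ln (R / max (norm (fst p)) (norm (snd p))) * (v (fst p) * f (norm (snd p))))
      \<le> log_form R v (\<lambda>y. f (norm y))"
    unfolding log_form_def
    by (rule max_kernel_le_log_kernel[OF v w]) (simp add: kernel_ratio_power_radial[OF v w f])
  have v': "(\<lambda>x. - v x) \<in> L2_on (ball 0 R)" using v by (auto simp: L2_on_def)
  have "(LINT p|(disc R \<Otimes>\<^sub>M disc R).
         ln (R / max (norm (fst p)) (norm (snd p))) * (- v (fst p) * f (norm (snd p))))
      \<le> log_form R (\<lambda>x. - v x) (\<lambda>y. f (norm y))"
    unfolding log_form_def
    by (rule max_kernel_le_log_kernel[OF v' w]) (use kernel_ratio_power_radial[OF v' w f] in simp)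
  then show "log_form R v (\<lambda>y. f (norm y)) \<le> (LINT p|(disc R \<Otimes>\<^sub>M disc R).
         ln (R / max (norm (fst p)) (norm (snd p))) * (v (fst p) * f (norm (snd p))))"
    by (simp add: log_form_def)
qed

section \<open>Potentials of powers of the norm\<close>

lemma has_bochner_integral_disc_powr:
  assumes "- 2 < a" "0 < R"
  shows "has_bochner_integral (disc R) (\<lambda>x. norm x powr a) (2 * pi * R powr (a + 2) / (a + 2))"
proof -
  have "((\<lambda>t. 2 * pi * t powr (a + 1)) has_integral 2 * pi * (R powr (a + 1 + 1) / (a + 1 + 1))) {0..R}"
    by (intro has_integral_mult_right has_integral_powr_from_0) (use assms in auto)
  then have "((\<lambda>t. 2 * pi * t * t powr a) has_integral 2 * pi * (R powr (a + 1 + 1) / (a + 1 + 1))) {0..R}"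
    by (rule has_integral_eq[rotated]) (simp add: powr_mult_base mult.assoc add.commute)
  then have "has_bochner_integral (disc R) (\<lambda>x. norm x powr a) (2 * pi * (R powr (a + 1 + 1) / (a + 1 + 1)))"
    by (intro has_bochner_integral_disc_radial) auto
  moreover have "a + 1 + 1 = a + 2" by simp
  ultimately show ?thesis by simp
qed

lemma powr_in_L2:
  assumes "- 1 < a" "0 < R"
  shows "(\<lambda>x. norm x powr a) \<in> L2_on (ball 0 R)"
proof -
  have "(\<lambda>x. (norm x powr a)\<^sup>2) = (\<lambda>x::real^2. norm x powr (2 * a))"
    by (simp add: fun_eq_iff power2_eq_square flip: powr_add)
  moreover have "(\<lambda>x::real^2. norm x powr a) \<in> borel_measurable (disc R)"
    by (rule borel_measurable_disc) measurable
  ultimately show ?thesis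
    using has_bochner_integral_disc_powr[of "2 * a" R] assms
    by (simp add: L2_on_def has_bochner_integral_iff)
qed

lemma L2_product_integrable:
  assumes v: "v \<in> L2_on (ball 0 R)" and w: "w \<in> L2_on (ball 0 R)"
  shows "integrable (disc R) (\<lambda>x. v x * w x)"
proof (rule Bochner_Integration.integrable_bound)
  show "integrable (disc R) (\<lambda>x. (v x)\<^sup>2 + (w x)\<^sup>2)" using v w by (simp add: L2_on_def)
  show "(\<lambda>x. v x * w x) \<in> borel_measurable (disc R)" using v w by (auto simp: L2_on_def)
  show "AE x in disc R. norm (v x * w x) \<le> norm ((v x)\<^sup>2 + (w x)\<^sup>2)"
    by (simp add: abs_mult_le_sum_squares)
qed

lemma L2_const: "(\<lambda>x. c) \<in> L2_on (ball 0 R)"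
  by (simp add: L2_on_def disc.integrable_const)

lemma L2_integrable: "v \<in> L2_on (ball 0 R) \<Longrightarrow> integrable (disc R) v"
  using L2_product_integrable[OF _ L2_const[of 1]] by simp

lemma L2_diff_scaled:
  assumes v: "v \<in> L2_on (ball 0 R)" and w: "w \<in> L2_on (ball 0 R)"
  shows "(\<lambda>x. v x - t * w x) \<in> L2_on (ball 0 R)"
proof -
  have "integrable (disc R) (\<lambda>x. (v x)\<^sup>2 - 2 * t * (v x * w x) + t\<^sup>2 * (w x)\<^sup>2)"
    using v w L2_product_integrable[OF v w] by (simp add: L2_on_def)
  also have "(\<lambda>x. (v x)\<^sup>2 - 2 * t * (v x * w x) + t\<^sup>2 * (w x)\<^sup>2) = (\<lambda>x. (v x - t * w x)\<^sup>2)"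
    by (simp add: fun_eq_iff power2_eq_square algebra_simps)
  finally show ?thesis using v w by (auto simp: L2_on_def)
qed

text \<open>The integral over radii below \<open>|x|\<close> has a constant logarithmic factor. On the radii \<open>t\<close> above
\<open>|x|\<close>, \<open>ln (R / t) t^N / N + t^N / N\<^sup>2\<close> is an antiderivative of \<open>ln (R / t) t^(N - 1)\<close>.\<close>

lemma max_kernel_powr_integral:
  fixes x :: "real^2"
  assumes N: "1 < N" and x: "x \<noteq> 0" "norm x < R"
  shows "(LINT y|disc R. ln (R / max (norm x) (norm y)) * norm y powr (N - 2))
           = 2 * pi / N\<^sup>2 * (R powr N - norm x powr N)"
proof -
  define r where "r = norm x"
  have r: "0 < r" "r < R" using x by (auto simp: r_def)
  define f where "f t = ln (R / max r t) * t powr (N - 2)" for t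
  define F where "F t = 2 * pi * (ln (R / t) * (t powr N / N) + t powr N / N\<^sup>2)" for t
  have powr_shift: "t * t powr (N - 2) = t powr (N - 1)" if "0 \<le> t" for t :: real
    using that by (simp add: powr_mult_base algebra_simps)
  have inner: "((\<lambda>t. 2 * pi * t * f t) has_integral 2 * pi * ln (R / r) * (r powr N / N)) {0..r}"
  proof -
    have "((\<lambda>t. 2 * pi * ln (R / r) * t powr (N - 1)) has_integral
            2 * pi * ln (R / r) * (r powr (N - 1 + 1) / (N - 1 + 1))) {0..r}"
      by (intro has_integral_mult_right has_integral_powr_from_0) (use N r in auto)
    then show ?thesis
      by (rule has_integral_eq[rotated, THEN back_subst[of "\<lambda>i. (_ has_integral i) _"]])
        (auto simp: f_def max_def powr_shift[symmetric] not_le)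
  qed
  have outer: "((\<lambda>t. 2 * pi * t * f t) has_integral F R - F r) {r..R}"
  proof (rule fundamental_theorem_of_calculus)
    fix t assume t: "t \<in> {r..R}"
    then have "t > 0" using r by auto
    have "(F has_real_derivative 2 * pi * (- (1 / t) * (t powr N / N)
            + ln (R / t) * t powr (N - 1) + N * t powr (N - 1) / N\<^sup>2)) (at t)"
      unfolding F_def using \<open>t > 0\<close> r N
      by (auto intro!: derivative_eq_intros simp: field_simps)
    moreover have "2 * pi * (- (1 / t) * (t powr N / N)
            + ln (R / t) * t powr (N - 1) + N * t powr (N - 1) / N\<^sup>2) = 2 * pi * t * f t"
    proof -
      have "t powr N = t * t powr (N - 1)" using \<open>t > 0\<close> by (simp add: powr_mult_base)
      then have "- (1 / t) * (t powr N / N) + N * t powr (N - 1) / N\<^sup>2 = 0"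
        using \<open>t > 0\<close> N by (simp add: power2_eq_square)
      then have "2 * pi * (- (1 / t) * (t powr N / N)
            + ln (R / t) * t powr (N - 1) + N * t powr (N - 1) / N\<^sup>2) = 2 * pi * (ln (R / t) * t powr (N - 1))"
        by simp
      also have "\<dots> = 2 * pi * t * f t" using t powr_shift[of t] \<open>t > 0\<close> by (simp add: f_def max_def)
      finally show ?thesis .
    qed
    ultimately have "(F has_real_derivative 2 * pi * t * f t) (at t)" by (simp only:)
    then show "(F has_vector_derivative 2 * pi * t * f t) (at t within {r..R})"
      unfolding has_real_derivative_iff_has_vector_derivative by (rule has_vector_derivative_at_within)
  qed (use r in auto)
  have "((\<lambda>t. 2 * pi * t * f t) has_integral 2 * pi * ln (R / r) * (r powr N / N) + (F R - F r)) {0..R}"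
    by (rule has_integral_combine[OF _ _ inner outer]) (use r in auto)
  also have "2 * pi * ln (R / r) * (r powr N / N) + (F R - F r) = 2 * pi / N\<^sup>2 * (R powr N - r powr N)"
    using r N by (simp add: F_def field_simps)
  finally have int: "((\<lambda>t. 2 * pi * t * f t) has_integral 2 * pi / N\<^sup>2 * (R powr N - r powr N)) {0..R}" .
  have "has_bochner_integral (disc R) (\<lambda>y. f (norm y)) (2 * pi / N\<^sup>2 * (R powr N - r powr N))"
  proof (rule has_bochner_integral_disc_radial[OF _ _ int])
    show "f \<in> borel_measurable borel" unfolding f_def by measurable
    show "0 \<le> f t" if "0 < t" "t < R" for t
      using that r by (auto simp: f_def)
  qed
  then show ?thesis by (simp add: has_bochner_integral_iff f_def r_def)
qed

lemma log_form_powr: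
  assumes v: "v \<in> L2_on (ball 0 R)" and N: "1 < N" and R: "0 < R"
  shows "log_form R v (\<lambda>y. norm y powr (N - 2))
    = 2 * pi / N\<^sup>2 * (R powr N * (LINT x|disc R. v x) - (LINT x|disc R. norm x powr N * v x))"
proof -
  have w: "(\<lambda>y. norm y powr (N - 2)) \<in> L2_on (ball 0 R)"
    using N R by (intro powr_in_L2) auto
  have v_meas [measurable]: "v \<in> borel_measurable (disc R)" using v by (simp add: L2_on_def)
  have norm_meas [measurable]: "(\<lambda>y::real^2. norm y) \<in> borel_measurable (disc R)"
    by (rule borel_measurable_disc) measurable
  have K_int: "integrable (disc R \<Otimes>\<^sub>M disc R)
      (\<lambda>p. ln (R / max (norm (fst p)) (norm (snd p))) * (v (fst p) * norm (snd p) powr (N - 2)))"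
    by (rule integrable_kernel[OF v w, where C = "1 + \<bar>ln R\<bar>"]) (auto simp: max_kernel_bound(1))
  have powr_v: "integrable (disc R) (\<lambda>x. norm x powr N * v x)"
    using N R v by (intro L2_product_integrable powr_in_L2) auto
  have "log_form R v (\<lambda>y. norm y powr (N - 2))
      = (LINT p|(disc R \<Otimes>\<^sub>M disc R).
           ln (R / max (norm (fst p)) (norm (snd p))) * (v (fst p) * norm (snd p) powr (N - 2)))"
    by (rule log_form_radial[OF v w]) measurable
  also have "\<dots> = (LINT x|disc R. LINT y|disc R. v x * (ln (R / max (norm x) (norm y)) * norm y powr (N - 2)))"
    using disc_pair.integral_fst'[OF K_int] by (simp add: mult.left_commute)
  also have "\<dots> = (LINT x|disc R. v x * (LINT y|disc R. ln (R / max (norm x) (norm y)) * norm y powr (N - 2)))"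
    by simp
  also have "\<dots> = (LINT x|disc R. v x * (2 * pi / N\<^sup>2 * (R powr N - norm x powr N)))"
  proof (rule integral_cong_AE)
    have "(\<lambda>x. LINT y|disc R. v x * (ln (R / max (norm x) (norm y)) * norm y powr (N - 2))) \<in> borel_measurable (disc R)"
      by measurable
    then show "(\<lambda>x. v x * (LINT y|disc R. ln (R / max (norm x) (norm y)) * norm y powr (N - 2))) \<in> borel_measurable (disc R)"
      by simp
    show "AE x in disc R. v x * (LINT y|disc R. ln (R / max (norm x) (norm y)) * norm y powr (N - 2))
        = v x * (2 * pi / N\<^sup>2 * (R powr N - norm x powr N))"
      using AE_disc_neq[where x = 0 and R = R] AE_space
    proof eventually_elim
      case (elim x)
      then show ?case using max_kernel_powr_integral[OF N, of x R] by auto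
    qed
  qed measurable
  also have "\<dots> = (LINT x|disc R. 2 * pi / N\<^sup>2 * (R powr N * v x - norm x powr N * v x))"
  proof -
    have "a * (c * (A - B)) = c * (A * a - B * a)" for a c A B :: real by (simp add: algebra_simps)
    then show ?thesis by (simp only:)
  qed
  also have "\<dots> = 2 * pi / N\<^sup>2 * (R powr N * (LINT x|disc R. v x) - (LINT x|disc R. norm x powr N * v x))"
    using powr_v L2_integrable[OF v] by simp
  finally show ?thesis .
qed

lemma integrable_log_form:
  assumes v: "v \<in> L2_on (ball 0 R)" and w: "w \<in> L2_on (ball 0 R)" and R: "0 < R"
  shows "integrable (disc R \<Otimes>\<^sub>M disc R) (\<lambda>p. ln (R / norm (fst p - snd p)) * (v (fst p) * w (snd p)))"
proof (rule integrable_kernel[OF v w, where C = "1 + \<bar>ln R\<bar>"])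
  fix x y :: "real^2" assume "x \<noteq> y"
  then have "ln (R / norm (x - y)) = ln R - ln (norm (x - y))" using R by (simp add: ln_div)
  then have "\<bar>ln (R / norm (x - y))\<bar> \<le> \<bar>ln R\<bar> + \<bar>ln (norm (x - y))\<bar>" by linarith
  also have "\<dots> \<le> (1 + \<bar>ln R\<bar>) * (1 + \<bar>ln (norm (x - y))\<bar>)" by (simp add: algebra_simps)
  finally show "\<bar>ln (R / norm (fst (x, y) - snd (x, y)))\<bar> \<le> (1 + \<bar>ln R\<bar>) * (1 + \<bar>ln (norm (x - y))\<bar>)"
    by simp
qed measurable

lemma log_form_commute:
  assumes v: "v \<in> L2_on (ball 0 R)" and w: "w \<in> L2_on (ball 0 R)" and R: "0 < R"
  shows "log_form R v w = log_form R w v"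
proof -
  have "log_form R w v = (\<integral>(x, y). ln (R / norm (y - x)) * (v y * w x) \<partial>(disc R \<Otimes>\<^sub>M disc R))"
    unfolding log_form_def
    by (intro Bochner_Integration.integral_cong) (auto simp: norm_minus_commute mult.commute)
  also have "\<dots> = log_form R v w"
    using disc_pair.integral_product_swap[OF borel_measurable_integrable[OF integrable_log_form[OF v w R]]]
    by (simp add: log_form_def)
  finally show ?thesis ..
qed

lemma log_form_diff_scaled:
  assumes v: "v \<in> L2_on (ball 0 R)" and w: "w \<in> L2_on (ball 0 R)" and R: "0 < R"
  shows "log_form R (\<lambda>x. v x - t * w x) (\<lambda>x. v x - t * w x)
    = log_form R v v - 2 * t * log_form R v w + t\<^sup>2 * log_form R w w"
proof -
  let ?g = "\<lambda>v w p. ln (R / norm (fst p - snd p)) * (v (fst p) * w (snd p))"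
  note int = integrable_log_form[OF _ _ R]
  have "log_form R (\<lambda>x. v x - t * w x) (\<lambda>x. v x - t * w x)
      = (LINT p|(disc R \<Otimes>\<^sub>M disc R). ?g v v p - t * ?g v w p - t * ?g w v p + t\<^sup>2 * ?g w w p)"
    unfolding log_form_def
    by (intro Bochner_Integration.integral_cong) (auto simp: algebra_simps power2_eq_square)
  also have "\<dots> = (LINT p|(disc R \<Otimes>\<^sub>M disc R). ?g v v p) - t * (LINT p|(disc R \<Otimes>\<^sub>M disc R). ?g v w p)
      - t * (LINT p|(disc R \<Otimes>\<^sub>M disc R). ?g w v p) + t\<^sup>2 * (LINT p|(disc R \<Otimes>\<^sub>M disc R). ?g w w p)"
    by (simp only: Bochner_Integration.integral_add Bochner_Integration.integral_diff integral_mult_right_zero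
        Bochner_Integration.integrable_add Bochner_Integration.integrable_diff integrable_mult_right
        int[OF v v] int[OF v w] int[OF w v] int[OF w w])
  also have "\<dots> = log_form R v v - 2 * t * log_form R v w + t\<^sup>2 * log_form R w w"
    using log_form_commute[OF v w R] by (simp add: log_form_def)
  finally show ?thesis .
qed

section \<open>Bounds for the smallest energy\<close>

lemma log_energy_disc:
  assumes v: "v \<in> L2_on (ball 0 R)" and R: "0 < R"
  shows "log_energy (ball 0 R) v = (log_form R v v - ln R * (LINT x|disc R. v x)\<^sup>2) / (2 * pi)"
proof -
  let ?P = "disc R \<Otimes>\<^sub>M disc R"
  have log_int: "integrable ?P (\<lambda>p. ln (1 / norm (fst p - snd p)) * (v (fst p) * v (snd p)))"
    by (rule integrable_kernel[OF v v, where C = 1]) (auto simp: ln_div)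
  have one_int: "integrable ?P (\<lambda>p. 1 * (v (fst p) * v (snd p)))"
    by (rule integrable_kernel[OF v v, where C = 1]) auto
  have "(LINT x|disc R. LINT y|disc R. ln (1 / norm (x - y)) * v x * v y)
      = (LINT p|?P. ln (1 / norm (fst p - snd p)) * (v (fst p) * v (snd p)))"
    using disc_pair.integral_fst'[OF log_int] by (simp add: mult.assoc)
  also have "\<dots> = (LINT p|?P. ln (R / norm (fst p - snd p)) * (v (fst p) * v (snd p))
                       - ln R * (1 * (v (fst p) * v (snd p))))"
  proof (rule integral_cong_AE)
    show "(\<lambda>p. ln (1 / norm (fst p - snd p)) * (v (fst p) * v (snd p))) \<in> borel_measurable ?P"
      using log_int by (rule borel_measurable_integrable)
    show "(\<lambda>p. ln (R / norm (fst p - snd p)) * (v (fst p) * v (snd p))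
                       - ln R * (1 * (v (fst p) * v (snd p)))) \<in> borel_measurable ?P"
      by (intro borel_measurable_integrable Bochner_Integration.integrable_diff
          integrable_mult_right[OF one_int] integrable_log_form[OF v v R])
    show "AE p in ?P. ln (1 / norm (fst p - snd p)) * (v (fst p) * v (snd p))
        = ln (R / norm (fst p - snd p)) * (v (fst p) * v (snd p)) - ln R * (1 * (v (fst p) * v (snd p)))"
      using AE_disc_pair_distinct
    proof eventually_elim
      case (elim p)
      then have "ln (1 / norm (fst p - snd p)) = ln (R / norm (fst p - snd p)) - ln R"
        using R by (simp add: ln_div)
      then show ?case by (simp add: left_diff_distrib)
    qed
  qed
  also have "\<dots> = log_form R v v - ln R * (LINT p|?P. 1 * (v (fst p) * v (snd p)))"
    using integrable_log_form[OF v v R] one_int by (simp add: log_form_def)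
  also have "(LINT p|?P. 1 * (v (fst p) * v (snd p))) = (LINT x|disc R. v x)\<^sup>2"
    using disc_pair.integral_fst'[OF one_int] by (simp add: power2_eq_square)
  finally show ?thesis by (simp add: log_energy_def)
qed

text \<open>Cauchy-Schwarz for the form \<open>B(u, v) + (2\<pi> / N\<^sup>2) \<integral>|x|\<^sup>2 u v\<close> between \<open>v\<close> and \<open>w = |x|^(N - 2)\<close>. The
weight \<open>|x|\<^sup>2\<close> turns \<open>w\<close> into \<open>|x|^N\<close>, which cancels the nonconstant part of the potential of \<open>w\<close>; so
pairing with \<open>w\<close> is a multiple of the plain integral.\<close>

lemma square_integral_le_log_form:
  assumes v: "v \<in> L2_on (ball 0 R)" and N: "1 < N" and R: "0 < R"
  shows "(LINT x|disc R. v x)\<^sup>2 \<le> N * log_form R v v + 2 * pi * R\<^sup>2 / N * (LINT x|disc R. (v x)\<^sup>2)"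
proof -
  define w where "w x = norm x powr (N - 2)" for x :: "real^2"
  have w: "w \<in> L2_on (ball 0 R)"
    unfolding w_def using N R by (intro powr_in_L2) auto
  note powr_L2 = powr_in_L2[OF _ R, of N]
  define I where "I u = (LINT x|disc R. u x)" for u :: "real^2 \<Rightarrow> real"
  define J where "J u = (LINT x|disc R. norm x powr N * u x)" for u :: "real^2 \<Rightarrow> real"
  define M where "M u = (LINT x|disc R. (norm x)\<^sup>2 * (u x)\<^sup>2)" for u :: "real^2 \<Rightarrow> real"
  have norm_w: "(norm x)\<^sup>2 * w x = norm x powr N" for x
  proof (cases "x = 0")
    case False
    then have "(norm x)\<^sup>2 = norm x powr 2" by simp
    then show ?thesis by (simp only: w_def powr_add[symmetric]) simp
  qed (simp add: w_def)
  have sq_int: "integrable (disc R) (\<lambda>x. (norm x)\<^sup>2 * (u x)\<^sup>2)" if u: "u \<in> L2_on (ball 0 R)" for u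
  proof (rule Bochner_Integration.integrable_bound)
    show "integrable (disc R) (\<lambda>x. R\<^sup>2 * (u x)\<^sup>2)" using u by (simp add: L2_on_def)
    have [measurable]: "(\<lambda>x::real^2. norm x) \<in> borel_measurable (disc R)" "u \<in> borel_measurable (disc R)"
      using u by (auto simp: L2_on_def intro: borel_measurable_disc)
    show "(\<lambda>x. (norm x)\<^sup>2 * (u x)\<^sup>2) \<in> borel_measurable (disc R)" by measurable
    show "AE x in disc R. norm ((norm x)\<^sup>2 * (u x)\<^sup>2) \<le> norm (R\<^sup>2 * (u x)\<^sup>2)"
      by (rule AE_I2) (auto simp: abs_mult intro!: mult_right_mono power_mono)
  qed
  have form_w: "log_form R u w = 2 * pi / N\<^sup>2 * (R powr N * I u - J u)" if "u \<in> L2_on (ball 0 R)" for u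
    using log_form_powr[OF that N R] by (simp add: w_def[abs_def] I_def J_def)
  have M_le: "M v \<le> R\<^sup>2 * (LINT x|disc R. (v x)\<^sup>2)"
  proof -
    have "M v \<le> (LINT x|disc R. R\<^sup>2 * (v x)\<^sup>2)"
      unfolding M_def using v sq_int[OF v]
      by (intro integral_mono) (auto simp: L2_on_def intro!: mult_right_mono power_mono)
    then show ?thesis by simp
  qed
  have I_w: "I w = 2 * pi * R powr N / N"
    using has_bochner_integral_disc_powr[of "N - 2" R] N R
    by (simp add: I_def w_def has_bochner_integral_iff)
  have M_w: "M w = J w"
    unfolding M_def J_def
    by (intro Bochner_Integration.integral_cong) (auto simp: power2_eq_square norm_w[symmetric] mult.assoc)
  \<comment> \<open>The minimiser in \<open>t\<close> of the quadratic form evaluated at \<open>v - t w\<close>.\<close>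
  define t where "t = N * I v / (2 * pi * R powr N)"
  let ?u = "\<lambda>x. v x - t * w x"
  have u: "?u \<in> L2_on (ball 0 R)" by (rule L2_diff_scaled[OF v w])
  have "M ?u = (LINT x|disc R. (norm x)\<^sup>2 * (v x)\<^sup>2 - 2 * t * (norm x powr N * v x)
                   + t\<^sup>2 * ((norm x)\<^sup>2 * (w x)\<^sup>2))"
    unfolding M_def
    by (intro Bochner_Integration.integral_cong)
       (auto simp: norm_w[symmetric] power2_eq_square algebra_simps)
  also have "\<dots> = M v - 2 * t * J v + t\<^sup>2 * M w"
    unfolding M_def J_def
    using sq_int[OF v] sq_int[OF w] L2_product_integrable[OF powr_L2 v] N by simp
  finally have M_u: "M ?u = M v - 2 * t * J v + t\<^sup>2 * J w" by (simp add: M_w)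
  have "0 \<le> log_form R ?u ?u" by (rule log_form_nonneg[OF u])
  moreover have "0 \<le> M ?u" unfolding M_def by (intro integral_nonneg_AE) auto
  ultimately have "0 \<le> log_form R ?u ?u + 2 * pi / N\<^sup>2 * M ?u" by simp
  also have "\<dots> = log_form R v v + 2 * pi / N\<^sup>2 * M v
      - 2 * t * (2 * pi / N\<^sup>2 * (R powr N * I v)) + t\<^sup>2 * (2 * pi / N\<^sup>2 * (R powr N * I w))"
  proof -
    define c where "c = 2 * pi / N\<^sup>2"
    show ?thesis
      unfolding log_form_diff_scaled[OF v w R] M_u form_w[OF v] form_w[OF w] c_def[symmetric]
      by (simp add: algebra_simps)
  qed
  also have "\<dots> = log_form R v v + 2 * pi / N\<^sup>2 * M v - (I v)\<^sup>2 / N"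
  proof -
    have "R powr N > 0" using R by simp
    then show ?thesis using N unfolding I_w t_def by (simp add: field_simps power2_eq_square)
  qed
  finally have "(I v)\<^sup>2 / N \<le> log_form R v v + 2 * pi / N\<^sup>2 * M v" by simp
  then have "(I v)\<^sup>2 \<le> N * (log_form R v v + 2 * pi / N\<^sup>2 * M v)"
    using N by (simp add: field_simps)
  also have "\<dots> = N * log_form R v v + 2 * pi / N * M v"
    using N by (simp add: field_simps power2_eq_square)
  also have "\<dots> \<le> N * log_form R v v + 2 * pi / N * (R\<^sup>2 * (LINT x|disc R. (v x)\<^sup>2))"
    using M_le N by (intro add_left_mono mult_left_mono) auto
  finally show ?thesis by (simp add: I_def)
qed

lemma square_integral_le_area:
  assumes v: "v \<in> L2_on (ball 0 R)" and R: "0 < R"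
  shows "(LINT x|disc R. v x)\<^sup>2 \<le> pi * R\<^sup>2 * (LINT x|disc R. (v x)\<^sup>2)"
proof -
  \<comment> \<open>The mean of \<open>v\<close>; the claim is that its variance is nonnegative.\<close>
  define t where "t = (LINT x|disc R. v x) / (pi * R\<^sup>2)"
  have area: "(LINT x|disc R. 1) = pi * R\<^sup>2"
  proof -
    have "measure lebesgue (ball (0::real^2) R) = pi * R\<^sup>2"
      using R by (simp add: content_ball unit_ball_vol_2)
    then show ?thesis by (simp add: measure_restrict_space space_restrict_space)
  qed
  have "0 \<le> (LINT x|disc R. (v x - t)\<^sup>2)" by simp
  also have "\<dots> = (LINT x|disc R. (v x)\<^sup>2 - 2 * t * v x + t\<^sup>2 * 1)"
    by (intro Bochner_Integration.integral_cong) (auto simp: power2_eq_square algebra_simps)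
  also have "\<dots> = (LINT x|disc R. (v x)\<^sup>2) - 2 * t * (LINT x|disc R. v x) + t\<^sup>2 * (pi * R\<^sup>2)"
    unfolding area[symmetric] using v L2_integrable[OF v]
    by (subst Bochner_Integration.integral_add) (auto simp: L2_on_def)
  also have "\<dots> = (LINT x|disc R. (v x)\<^sup>2) - (LINT x|disc R. v x)\<^sup>2 / (pi * R\<^sup>2)"
    using R by (simp add: t_def field_simps power2_eq_square)
  finally show ?thesis using R by (simp add: field_simps)
qed

lemma powr_trial_energy:
  assumes R: "0 < R" and N: "1 < N"
  obtains u where "u \<in> L2_on (ball 0 R)" "L2_norm_on (ball 0 R) u = 1"
    "log_energy (ball 0 R) u = R\<^sup>2 * ((N - 1) * (1 - 2 * N * ln R) / N ^ 3)"
proof -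
  define w where "w x = norm x powr (N - 2)" for x :: "real^2"
  define s where "s = (LINT x|disc R. (w x)\<^sup>2)"
  define u where "u x = w x / sqrt s" for x
  have w: "w \<in> L2_on (ball 0 R)"
    unfolding w_def using N R by (intro powr_in_L2) auto
  have int_powr: "(LINT x|disc R. norm x powr a) = 2 * pi * R powr (a + 2) / (a + 2)" if "- 2 < a" for a
    using has_bochner_integral_disc_powr[OF that R] by (simp add: has_bochner_integral_iff)
  have "(w x)\<^sup>2 = norm x powr (2 * N - 4)" for x
    by (simp add: w_def power2_eq_square flip: powr_add)
  then have s_eq: "s = 2 * pi * R powr (2 * N - 2) / (2 * N - 2)"
    unfolding s_def using int_powr[of "2 * N - 4"] N by simp
  then have s: "0 < s" using N R by simp
  have int_w: "(LINT x|disc R. w x) = 2 * pi * R powr N / N"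
    unfolding w_def using int_powr[of "N - 2"] N by simp
  have "norm x powr N * w x = norm x powr (2 * N - 2)" for x
    by (simp add: w_def flip: powr_add)
  then have "(LINT x|disc R. norm x powr N * w x) = 2 * pi * R powr (2 * N) / (2 * N)"
    using int_powr[of "2 * N - 2"] N by simp
  then have form_w: "log_form R w w = 2 * pi / N\<^sup>2 * (R powr N * (2 * pi * R powr N / N) - 2 * pi * R powr (2 * N) / (2 * N))"
    using log_form_powr[OF w N R] int_w by (simp add: w_def[abs_def])
  have u: "u \<in> L2_on (ball 0 R)"
    using w unfolding u_def L2_on_def by (auto simp: power_divide)
  have "(LINT x|disc R. (u x)\<^sup>2) = 1"
    using s by (simp add: u_def power_divide s_def[symmetric])
  then have u_norm: "L2_norm_on (ball 0 R) u = 1" by (simp add: L2_norm_on_def)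
  have form_u: "log_form R u u = log_form R w w / s"
    using s by (simp add: log_form_def u_def)
  have int_u: "(LINT x|disc R. u x)\<^sup>2 = (2 * pi * R powr N / N)\<^sup>2 / s"
    using s by (simp add: u_def int_w power_divide power_mult_distrib)
  have R2N: "R powr (2 * N) = R powr N * R powr N" "R powr (2 * N - 2) = R powr N * R powr N / R\<^sup>2"
    using R by (simp_all add: powr_diff flip: powr_add)
  have "log_energy (ball 0 R) u = R\<^sup>2 * ((N - 1) * (1 - 2 * N * ln R) / N ^ 3)"
  proof -
    define A where "A = R powr N"
    have A: "0 < A" using R by (simp add: A_def)
    show ?thesis
      unfolding log_energy_disc[OF u R] form_u int_u form_w s_eq R2N A_def[symmetric]
      using A R N by (simp add: divide_simps) (simp add: power2_eq_square power3_eq_cube algebra_simps)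
  qed
  with u u_norm that show thesis by blast
qed

text \<open>The choice \<open>N = 1 / ln R\<close> in \<open>square_integral_le_log_form\<close> makes \<open>B\<close> absorb the negative term
\<open>ln R (\<integral>u)\<^sup>2\<close> of the energy exactly. That choice is admissible when \<open>ln R < 1\<close>.\<close>

lemma tau1_disc_bounds:
  assumes R: "1 < R"
  shows "- (R\<^sup>2 * ln R / 2) \<le> tau1 (ball 0 R)"
    and "ln R < 1 \<Longrightarrow> - (R\<^sup>2 * (ln R)\<^sup>2) \<le> tau1 (ball 0 R)"
    and "1 < N \<Longrightarrow> tau1 (ball 0 R) \<le> R\<^sup>2 * ((N - 1) * (1 - 2 * N * ln R) / N ^ 3)"
proof -
  define E where "E = {log_energy (ball 0 R) u | u. u \<in> L2_on (ball 0 R) \<and> L2_norm_on (ball 0 R) u = 1}"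
  have tau: "tau1 (ball 0 R) = Inf E" by (simp add: tau1_def E_def)
  have R0: "0 < R" and L: "0 < ln R" using R by auto
  obtain u2 where "log_energy (ball 0 R) u2 \<in> E"
    using powr_trial_energy[of R 2] R0 unfolding E_def by fastforce
  then have nonempty: "E \<noteq> {}" by auto
  have low1: "- (R\<^sup>2 * ln R / 2) \<le> e" if e_in: "e \<in> E" for e
  proof -
    obtain u where u: "u \<in> L2_on (ball 0 R)" "(LINT x|disc R. (u x)\<^sup>2) = 1" and e: "e = log_energy (ball 0 R) u"
      using e_in by (auto simp: E_def L2_norm_on_def)
    have "(LINT x|disc R. u x)\<^sup>2 \<le> pi * R\<^sup>2"
      using square_integral_le_area[OF u(1) R0] u(2) by simp
    then have "ln R * (LINT x|disc R. u x)\<^sup>2 \<le> ln R * (pi * R\<^sup>2)"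
      using L by (intro mult_left_mono) auto
    with log_form_nonneg[OF u(1)] have "- (ln R * (pi * R\<^sup>2)) / (2 * pi) \<le> e"
      unfolding e log_energy_disc[OF u(1) R0] by (intro divide_right_mono) auto
    then show ?thesis by (simp add: mult.commute)
  qed
  then have bdd: "bdd_below E" by (auto simp: bdd_below_def)
  show "- (R\<^sup>2 * ln R / 2) \<le> tau1 (ball 0 R)"
    unfolding tau using nonempty low1 by (rule cInf_greatest)
  show "- (R\<^sup>2 * (ln R)\<^sup>2) \<le> tau1 (ball 0 R)" if L1: "ln R < 1"
    unfolding tau
  proof (rule cInf_greatest[OF nonempty])
    fix e assume "e \<in> E"
    then obtain u where u: "u \<in> L2_on (ball 0 R)" "(LINT x|disc R. (u x)\<^sup>2) = 1" and e: "e = log_energy (ball 0 R) u"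
      by (auto simp: E_def L2_norm_on_def)
    have "1 < 1 / ln R" using L L1 by simp
    from square_integral_le_log_form[OF u(1) this R0]
    have "(LINT x|disc R. u x)\<^sup>2 \<le> log_form R u u / ln R + 2 * pi * R\<^sup>2 * ln R"
      by (simp add: u(2))
    then have "ln R * (LINT x|disc R. u x)\<^sup>2 \<le> ln R * (log_form R u u / ln R + 2 * pi * R\<^sup>2 * ln R)"
      using L by (intro mult_left_mono) auto
    also have "\<dots> = log_form R u u + 2 * pi * (R\<^sup>2 * (ln R)\<^sup>2)"
      using L by (simp add: field_simps power2_eq_square)
    finally have "- (2 * pi * (R\<^sup>2 * (ln R)\<^sup>2)) / (2 * pi) \<le> e"
      unfolding e log_energy_disc[OF u(1) R0] by (intro divide_right_mono) auto
    then show "- (R\<^sup>2 * (ln R)\<^sup>2) \<le> e" by simp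
  qed
  show "tau1 (ball 0 R) \<le> R\<^sup>2 * ((N - 1) * (1 - 2 * N * ln R) / N ^ 3)" if N: "1 < N"
  proof -
    obtain u where "u \<in> L2_on (ball 0 R)" "L2_norm_on (ball 0 R) u = 1"
      "log_energy (ball 0 R) u = R\<^sup>2 * ((N - 1) * (1 - 2 * N * ln R) / N ^ 3)"
      by (rule powr_trial_energy[OF R0 N])
    then have "R\<^sup>2 * ((N - 1) * (1 - 2 * N * ln R) / N ^ 3) \<in> E" unfolding E_def by force
    then show ?thesis unfolding tau using bdd by (rule cInf_lower)
  qed
qed

theorem theorem1p11:
  shows "((\<lambda>R::real. tau1 (ball 0 R) / (- (R\<^sup>2 * (ln R)\<^sup>2))) \<longlongrightarrow> 1) (at_right 1)
       \<and> ((\<lambda>R::real. tau1 (ball 0 R) / (- (1 / 2 * R\<^sup>2 * ln R))) \<longlongrightarrow> 1) at_top"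
proof
  have near: "1 - ln R \<le> tau1 (ball 0 R) / (- (R\<^sup>2 * (ln R)\<^sup>2))
        \<and> tau1 (ball 0 R) / (- (R\<^sup>2 * (ln R)\<^sup>2)) \<le> 1" if R: "1 < R" "R < exp 1" for R
  proof -
    have L: "0 < ln R" "ln R < 1" using R ln_less_cancel_iff[of R "exp 1"] by auto
    define l where "l = ln R"
    have l: "0 < l" "l < 1" using L by (auto simp: l_def)
    have pos: "0 < R\<^sup>2 * l\<^sup>2" using R l by simp
    have "(1 / l - 1) * (1 - 2 * (1 / l) * l) / (1 / l) ^ 3 = - (l\<^sup>2 * (1 - l))"
      using l by (simp add: field_simps power2_eq_square power3_eq_cube)
    then have "tau1 (ball 0 R) \<le> - (R\<^sup>2 * l\<^sup>2 * (1 - l))"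
      using tau1_disc_bounds(3)[OF R(1), of "1 / l"] l by (simp add: l_def)
    moreover have "- (R\<^sup>2 * l\<^sup>2) \<le> tau1 (ball 0 R)"
      using tau1_disc_bounds(2)[OF R(1)] L by (simp add: l_def)
    ultimately have "(1 - l) * (R\<^sup>2 * l\<^sup>2) \<le> - tau1 (ball 0 R)" "- tau1 (ball 0 R) \<le> 1 * (R\<^sup>2 * l\<^sup>2)"
      by (simp_all add: mult.commute)
    then show ?thesis using pos_le_divide_eq[OF pos] pos_divide_le_eq[OF pos]
      unfolding l_def[symmetric] minus_divide_right[symmetric] minus_divide_left by blast
  qed
  have near_ev: "\<forall>\<^sub>F R in at_right 1. 1 < R \<and> R < exp (1::real)"
    using eventually_at_right[of 1 "exp 1"] by (auto simp: eventually_at_right_field intro!: exI[of _ "exp 1"])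
  show "((\<lambda>R::real. tau1 (ball 0 R) / (- (R\<^sup>2 * (ln R)\<^sup>2))) \<longlongrightarrow> 1) (at_right 1)"
  proof (rule tendsto_sandwich)
    show "\<forall>\<^sub>F R in at_right 1. 1 - ln R \<le> tau1 (ball 0 R) / (- (R\<^sup>2 * (ln R)\<^sup>2))"
      using near_ev by eventually_elim (use near in blast)
    show "\<forall>\<^sub>F R in at_right 1. tau1 (ball 0 R) / (- (R\<^sup>2 * (ln R)\<^sup>2)) \<le> 1"
      using near_ev by eventually_elim (use near in blast)
    show "((\<lambda>R::real. 1 - ln R) \<longlongrightarrow> 1) (at_right 1)"
      by (auto intro!: tendsto_eq_intros)
  qed simp
  have far: "1 - 1 / (4 * ln R) \<le> tau1 (ball 0 R) / (- (1 / 2 * R\<^sup>2 * ln R))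
        \<and> tau1 (ball 0 R) / (- (1 / 2 * R\<^sup>2 * ln R)) \<le> 1" if R: "1 < R" for R
  proof -
    define l where "l = ln R"
    have l: "0 < l" using R by (simp add: l_def)
    have pos: "0 < 1 / 2 * R\<^sup>2 * l" using R l by simp
    have "tau1 (ball 0 R) \<le> R\<^sup>2 * ((1 - 4 * l) / 8)"
      using tau1_disc_bounds(3)[OF R, of 2] by (simp add: l_def)
    moreover have "- (R\<^sup>2 * l / 2) \<le> tau1 (ball 0 R)"
      using tau1_disc_bounds(1)[OF R] by (simp add: l_def)
    moreover have "(1 - 1 / (4 * l)) * (1 / 2 * R\<^sup>2 * l) = - (R\<^sup>2 * ((1 - 4 * l) / 8))"
      using l by (simp add: field_simps)
    ultimately have "(1 - 1 / (4 * l)) * (1 / 2 * R\<^sup>2 * l) \<le> - tau1 (ball 0 R)"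
        "- tau1 (ball 0 R) \<le> 1 * (1 / 2 * R\<^sup>2 * l)"
      by simp_all
    then show ?thesis using pos_le_divide_eq[OF pos] pos_divide_le_eq[OF pos]
      unfolding l_def[symmetric] minus_divide_right[symmetric] minus_divide_left by blast
  qed
  have far_ev: "\<forall>\<^sub>F R in at_top. 1 < (R::real)" by (rule eventually_gt_at_top)
  show "((\<lambda>R::real. tau1 (ball 0 R) / (- (1 / 2 * R\<^sup>2 * ln R))) \<longlongrightarrow> 1) at_top"
  proof (rule tendsto_sandwich)
    show "\<forall>\<^sub>F R in at_top. 1 - 1 / (4 * ln R) \<le> tau1 (ball 0 R) / (- (1 / 2 * R\<^sup>2 * ln R))"
      using far_ev by eventually_elim (use far in blast)
    show "\<forall>\<^sub>F R in at_top. tau1 (ball 0 R) / (- (1 / 2 * R\<^sup>2 * ln R)) \<le> 1"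
      using far_ev by eventually_elim (use far in blast)
    have "((\<lambda>R::real. inverse (ln R)) \<longlongrightarrow> 0) at_top"
      using tendsto_inverse_0_at_top[OF ln_at_top] .
    then have "((\<lambda>R::real. 1 - 1 / 4 * inverse (ln R)) \<longlongrightarrow> 1 - 1 / 4 * 0) at_top"
      by (intro tendsto_intros)
    then show "((\<lambda>R::real. 1 - 1 / (4 * ln R)) \<longlongrightarrow> 1) at_top"
      by (simp add: field_simps)
  qed simp
qed

end
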